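(* There are absolute constants $C,c>0$ such that the following holds. Let $P\subset\mathbb{R}^2\setminus\{0\}$ be a finite nonempty set contained in an angular sector with apex at the origin and angle less than $\pi/2$. Let $N=|P|$, $t=|\Lambda(P)|$, let $D$ be the number of occupied rays, and let $a_1,\dots,a_D$ be the numbers of points of $P$ on the occupied rays, so that $\sum_{i=1}^D a_i=N$. For $p\in P$ put $\tau_p=|\{p\cdot q:q\in P\}|$. Then for every $p\in P$, $$\sum_{i=1}^D a_i^3\ \le\ C\,\tau_p^{31/42}\,t^{16/7}\,N^{11/42}.$$ In particular, putting $H_2=D^2\sum_{i=1}^D a_i^3/N^3$ and $J_p=t/\tau_p$, one has $H_2\ge1$, $J_p\ge1$ and $$t\ \ge\ c\,H_2^{42/295}\,J_p^{31/295}\,N^{199/295}.$$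
   Context: $\Lambda(P)=\{p\cdot q:p,q\in P\}$ is the set of dot products (self-pairs included), with the standard inner product. A ray is an open half-line emanating from the origin; it is occupied if it contains at least one point of $P$. *)

theory Defs
  imports "HOL-Analysis.Analysis"
begin

definition dot_products :: "(real^2) set \<Rightarrow> real set" where
  "dot_products P = {p \<bullet> q |p q. p \<in> P \<and> q \<in> P}"

definition pinned_dot_products :: "(real^2) set \<Rightarrow> real^2 \<Rightarrow> real set" where
  "pinned_dot_products P p = {p \<bullet> q |q. q \<in> P}"

definition is_ray :: "(real^2) set \<Rightarrow> bool" where
  "is_ray R \<longleftrightarrow> (\<exists>u. u \<noteq> 0 \<and> R = {s *\<^sub>R u |s. s > 0})"

definition occupied_rays :: "(real^2) set \<Rightarrow> (real^2) set set" where
  "occupied_rays P = {R. is_ray R \<and> R \<inter> P \<noteq> {}}"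

(* Closed sector spanned by the directions between the angles alpha and alpha + phi.
   For the condition of lying in some sector of angle less than pi/2 it does not matter
   whether sectors are open or closed, since the angle can be enlarged slightly. *)
definition angular_sector :: "real \<Rightarrow> real \<Rightarrow> (real^2) set" where
  "angular_sector \<alpha> \<phi> =
     {vector [r * cos \<theta>, r * sin \<theta>] |r \<theta>. 0 \<le> r \<and> \<alpha> \<le> \<theta> \<and> \<theta> \<le> \<alpha> + \<phi>}"

(* The numbers a_1, ..., a_D are the values card (P \<inter> R) for R in occupied_rays P,
   indexed by the rays themselves. *)
definition ray_cube_sum :: "(real^2) set \<Rightarrow> real" where
  "ray_cube_sum P = (\<Sum>R\<in>occupied_rays P. real (card (P \<inter> R)) ^ 3)"

definition H2 :: "(real^2) set \<Rightarrow> real" where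
  "H2 P = real (card (occupied_rays P)) ^ 2 * ray_cube_sum P / real (card P) ^ 3"

definition J :: "(real^2) set \<Rightarrow> real^2 \<Rightarrow> real" where
  "J P p = real (card (dot_products P)) / real (card (pinned_dot_products P p))"

end

theory Submission
  imports Defs
begin

text \<open>Write points in the coordinates along and across \<open>p\<close>, so that a point is a radius
  times a point \<open>(1, y)\<close> and the dot product of two points is, up to a common factor,
  \<open>r s (1 + y z)\<close>. Some line orthogonal to \<open>p\<close> carries many points, hence a
  set \<open>Y\<close> of slopes; suppose that all its rays have at least \<open>a\<close> points. Multiplying
  alternately by \<open>(1 + y z)\<close> and its inverse along a walk in \<open>Y\<close>, the radii at the
  interior vertices cancel, so walks with \<open>k + 1\<close> edges produce at most
  \<open>t ^ (k + 1) / a ^ k\<close> distinct products. On the other hand walks with 9 edges produce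
  at least a constant times \<open>card Y ^ 3\<close> products: cross ratios of consecutive elements of
  \<open>Y\<close> squeeze into the gaps of a set of quadratic size, and a linear number of distinct cross
  ratios is small enough for this because the rows of the matrix of cross ratios behave like
  pseudolines in a grid. This gives \<open>card Y ^ 3 * a ^ 8 \<le> C * t ^ 9\<close>, which is stronger
  than needed and is summed over all values of \<open>a\<close>.

  The second inequality follows from the first and the Szemeredi-Trotter type bound
  \<open>D * N \<le> C * t\<^sup>2\<close>: with one pin on each ray, ordered by slope, the points of \<open>P\<close>
  are again pseudolines in a grid, and the crossing lemma between consecutive columns is proved by
  sampling.\<close>

subsection \<open>Pseudolines in a grid\<close>

text \<open>An element of \<open>E\<close> is read as a segment joining a point of one vertical line
  to a point of another. Ordering the pair by \<open>fst\<close> counts each crossing once; segments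
  with a common end do not cross.\<close>

definition crossings :: "(real \<times> real) set \<Rightarrow> ((real \<times> real) \<times> (real \<times> real)) set" where
  "crossings E = {(d, e). d \<in> E \<and> e \<in> E \<and> fst d < fst e \<and> snd e < snd d}"

lemma finite_crossings: "finite E \<Longrightarrow> finite (crossings E)"
  by (rule finite_subset[of _ "E \<times> E"]) (auto simp: crossings_def)

lemma card_less_mono:
  fixes a b :: "'a :: linorder"
  assumes "finite A" "a \<in> A" "a < b"
  shows "card {x \<in> A. x < a} < card {x \<in> A. x < b}"
  by (rule psubset_card_mono) (use assms in auto)

lemma card_less_less:
  fixes a :: "'a :: linorder"
  assumes "finite A" "a \<in> A"
  shows "card {x \<in> A. x < a} < card A"
  by (rule psubset_card_mono) (use assms in auto)

text \<open>Two edges whose ends have the same sum of ranks cross. There are at most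
  \<open>card A + card B\<close> rank sums; after one edge is kept for each, every other edge is
  charged to a crossing of its own.\<close>

lemma card_le_crossings:
  assumes fin: "finite A" "finite B" and E: "E \<subseteq> A \<times> B"
  shows "card E \<le> card A + card B + card (crossings E)"
proof -
  have finE: "finite E" using E fin by (meson finite_SigmaI finite_subset)
  define g where "g e = card {x \<in> A. x < fst e} + card {x \<in> B. x < snd e}" for e
  have cross: "snd e < snd d" if "d \<in> E" "e \<in> E" "g d = g e" "fst d < fst e" for d e
  proof (rule ccontr)
    assume "\<not> snd e < snd d"
    then have "card {x \<in> B. x < snd d} \<le> card {x \<in> B. x < snd e}"
      by (intro card_mono) (use fin in auto)
    moreover have "card {x \<in> A. x < fst d} < card {x \<in> A. x < fst e}"
      using that E by (intro card_less_mono fin) auto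
    ultimately show False using that(3) by (simp add: g_def)
  qed
  have eq: "d = e" if "d \<in> E" "e \<in> E" "g d = g e" "fst d = fst e" for d e
  proof -
    have "snd d = snd e"
      using card_less_mono[OF fin(2), of "snd d" "snd e"] card_less_mono[OF fin(2), of "snd e" "snd d"]
        that E by (cases "snd d" "snd e" rule: linorder_cases) (auto simp: g_def)
    with that show ?thesis by (simp add: prod_eq_iff)
  qed
  \<comment> \<open>The leftmost edge for each rank sum. Any other edge has some edge
    \<open>d\<close> further left with the same rank sum, and crosses it.\<close>
  define G where "G = {e \<in> E. \<forall>d\<in>E. g d = g e \<longrightarrow> fst e \<le> fst d}"
  have "inj_on g G"
    by (rule inj_onI, rule eq) (simp_all add: G_def order_antisym)
  moreover have "g e < card A + card B" if "e \<in> G" for e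
    unfolding g_def using that E by (intro add_strict_mono card_less_less fin) (auto simp: G_def)
  then have "g ` G \<subseteq> {..<card A + card B}" by auto
  ultimately have G: "card G \<le> card A + card B"
    by (metis card_inj_on_le card_lessThan finite_lessThan)
  have "\<exists>d. (d, e) \<in> crossings E" if e: "e \<in> E - G" for e
  proof -
    obtain d where d: "d \<in> E" "g d = g e" "fst d < fst e" using e by (auto simp: G_def not_le)
    then have "(d, e) \<in> crossings E" using cross[of d e] e by (simp add: crossings_def)
    then show ?thesis ..
  qed
  then obtain h where h: "\<And>e. e \<in> E - G \<Longrightarrow> (h e, e) \<in> crossings E" by metis
  have "card (E - G) \<le> card (crossings E)"
    by (rule card_inj_on_le[of "\<lambda>e. (h e, e)"]) (use h finite_crossings[OF finE] in \<open>auto simp: inj_on_def\<close>)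
  moreover have "card E = card G + card (E - G)"
    using finE by (metis (no_types, lifting) G_def card_Diff_subset card_mono finite_subset
        le_add_diff_inverse mem_Collect_eq subsetI)
  ultimately show ?thesis using G by linarith
qed

section \<open>Random sampling and the crossing lemma\<close>

lemma PiE_zero: fixes k :: nat
  assumes "k > 0" "Z \<subseteq> A"
  shows "{f \<in> PiE A (\<lambda>_. {..<k}). \<forall>a\<in>Z. f a = 0} = PiE A (\<lambda>x. if x \<in> Z then {0} else {..<k})"
proof (rule set_eqI)
  fix f
  show "f \<in> {f \<in> PiE A (\<lambda>_. {..<k}). \<forall>a\<in>Z. f a = 0} \<longleftrightarrow> f \<in> PiE A (\<lambda>x. if x \<in> Z then {0} else {..<k})"
    using assms unfolding PiE_iff mem_Collect_eq by (smt (verit) empty_iff insert_iff lessThan_iff subsetD)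
qed
text \<open>A uniformly random colouring vanishes on \<open>Z\<close> with probability
  \<open>1 / k ^ card Z\<close>; multiplied out, this stays in \<open>nat\<close>.\<close>

lemma card_PiE_zero:
  fixes k :: nat
  assumes "finite A" "Z \<subseteq> A" "k > 0"
  shows "k ^ card Z * card {f \<in> PiE A (\<lambda>_. {..<k}). \<forall>a\<in>Z. f a = 0} = k ^ card A"
proof -
  have "card {f \<in> PiE A (\<lambda>_. {..<k}). \<forall>a\<in>Z. f a = 0} = (\<Prod>x\<in>A. card (if x \<in> Z then {0} else {..<k}))"
    unfolding PiE_zero[OF assms(3,2)] by (rule card_PiE[OF assms(1)])
  also have "\<dots> = (\<Prod>x\<in>A - Z. k)"
    using assms by (intro prod.mono_neutral_cong_right) auto
  also have "\<dots> = k ^ (card A - card Z)"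
    using assms by (simp add: card_Diff_subset finite_subset)
  finally show ?thesis
    using assms by (simp add: card_mono flip: power_add)
qed

lemma sum_card_swap:
  assumes "finite S" "finite T"
  shows "(\<Sum>f\<in>S. card {e \<in> T. R f e}) = (\<Sum>e\<in>T. card {f \<in> S. R f e})"
  using sum.swap[of "\<lambda>f e. if R f e then 1 else (0::nat)" T S] assms
  by (simp add: sum.If_cases Int_def)

text \<open>The zero set of a uniformly random colouring of \<open>A\<close> with \<open>k\<close> colours contains each element
  with probability \<open>1 / k\<close> and each pair with probability \<open>1 / k ^ 2\<close>.\<close>

lemma card_sampling:
  fixes u :: "'e \<Rightarrow> 'a" and v w :: "'c \<Rightarrow> 'a" and k \<alpha> \<beta> \<gamma> :: nat
  assumes fin: "finite A" "finite E" "finite C" and "k > 0"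
    and u: "\<And>e. e \<in> E \<Longrightarrow> u e \<in> A"
    and vw: "\<And>x. x \<in> C \<Longrightarrow> v x \<in> A \<and> w x \<in> A \<and> v x \<noteq> w x"
    and le: "\<And>A'. A' \<subseteq> A \<Longrightarrow>
      \<alpha> * card {e \<in> E. u e \<in> A'} \<le> \<beta> * card A' + \<gamma> + card {x \<in> C. v x \<in> A' \<and> w x \<in> A'}"
  shows "k * \<alpha> * card E \<le> k * \<beta> * card A + k ^ 2 * \<gamma> + card C"
proof -
  define F where "F = PiE A (\<lambda>_. {..<k})"
  have finF: "finite F" using fin by (simp add: F_def finite_PiE)
  have cF: "card F = k ^ card A" using fin by (simp add: F_def card_PiE)
  \<comment> \<open>The expectation of \<open>le\<close> for the zero set of a random colouring,
    written as a sum over all colourings.\<close>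
  have total: "\<alpha> * (\<Sum>f\<in>F. card {e \<in> E. f (u e) = 0}) \<le> \<beta> * (\<Sum>f\<in>F. card {a \<in> A. f a = 0}) + card F * \<gamma>
      + (\<Sum>f\<in>F. card {x \<in> C. f (v x) = 0 \<and> f (w x) = 0})"
  proof -
    have "\<alpha> * card {e \<in> E. f (u e) = 0} \<le> \<beta> * card {a \<in> A. f a = 0} + \<gamma>
      + card {x \<in> C. f (v x) = 0 \<and> f (w x) = 0}" for f :: "'a \<Rightarrow> nat"
    proof -
      have "{e \<in> E. u e \<in> {a \<in> A. f a = 0}} = {e \<in> E. f (u e) = 0}"
        "{x \<in> C. v x \<in> {a \<in> A. f a = 0} \<and> w x \<in> {a \<in> A. f a = 0}} = {x \<in> C. f (v x) = 0 \<and> f (w x) = 0}"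
        using u vw by auto
      then show ?thesis using le[of "{a \<in> A. f a = 0}"] by simp
    qed
    then have "(\<Sum>f\<in>F. \<alpha> * card {e \<in> E. f (u e) = 0}) \<le> (\<Sum>f\<in>F. \<beta> * card {a \<in> A. f a = 0} + \<gamma>
      + card {x \<in> C. f (v x) = 0 \<and> f (w x) = 0})"
      by (intro sum_mono) 
    then show ?thesis by (simp add: sum.distrib sum_distrib_left)
  qed
  have E: "k * (\<Sum>f\<in>F. card {e \<in> E. f (u e) = 0}) = card E * k ^ card A"
    unfolding sum_card_swap[OF finF fin(2)] unfolding sum_distrib_left F_def
    using card_PiE_zero[OF fin(1) _ \<open>k > 0\<close>, of "{u _}"] u by simp
  have A: "k * (\<Sum>f\<in>F. card {a \<in> A. f a = 0}) = card A * k ^ card A"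
    unfolding sum_card_swap[OF finF fin(1)] unfolding sum_distrib_left F_def
    using card_PiE_zero[OF fin(1) _ \<open>k > 0\<close>, of "{_}"] by simp
  have "k ^ 2 * card {f \<in> F. f (v x) = 0 \<and> f (w x) = 0} = k ^ card A" if "x \<in> C" for x
    using card_PiE_zero[OF fin(1) _ \<open>k > 0\<close>, of "{v x, w x}"] vw[OF that] by (simp add: F_def power2_eq_square)
  then have C: "k ^ 2 * (\<Sum>f\<in>F. card {x \<in> C. f (v x) = 0 \<and> f (w x) = 0}) = card C * k ^ card A"
    unfolding sum_card_swap[OF finF fin(3)] unfolding sum_distrib_left by simp
  have "k * \<alpha> * (k * a) \<le> k * \<beta> * (k * b) + k ^ 2 * (c * \<gamma>) + k ^ 2 * d"
    if "\<alpha> * a \<le> \<beta> * b + c * \<gamma> + d" for a b c d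
    using mult_le_mono2[OF that, of "k ^ 2"] by (simp add: algebra_simps power2_eq_square)
  from this[OF total] have "k * \<alpha> * (card E * k ^ card A) \<le>
      k * \<beta> * (card A * k ^ card A) + k ^ 2 * (k ^ card A * \<gamma>) + card C * k ^ card A"
    unfolding E A C cF .
  then have "k ^ card A * (k * \<alpha> * card E) \<le> k ^ card A * (k * \<beta> * card A + k ^ 2 * \<gamma> + card C)"
    by (simp add: algebra_simps)
  then show ?thesis using \<open>k > 0\<close> by simp
qed

text \<open>Sampling both sides with probability \<open>1 / k\<close> in
  \<open>card_le_crossings\<close> keeps a vertex with probability \<open>1 / k\<close>, an edge
  with \<open>1 / k ^ 2\<close> and a crossing with \<open>1 / k ^ 4\<close>, since a crossing has
  four distinct ends. The result is multiplied by \<open>k ^ 4\<close>; \<open>k\<close> stays free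
  for later optimisation.\<close>

lemma crossing_lemma:
  assumes fin: "finite A" "finite B" and E: "E \<subseteq> A \<times> B" and k: "k > 0"
  shows "k ^ 2 * card E \<le> k ^ 3 * (card A + card B) + card (crossings E)"
proof -
  have finE: "finite E" using E fin by (meson finite_SigmaI finite_subset)
  \<comment> \<open>\<open>A\<close> is sampled first, with the other side fixed; the resulting
    bound is the input for sampling \<open>B\<close>.\<close>
  have step: "k * card E' \<le> k * card A + k ^ 2 * card B' + card (crossings E')"
    if "E' \<subseteq> A \<times> B'" "B' \<subseteq> B" for E' B'
  proof -
    have finB': "finite B'" and finE': "finite E'"
      using that fin by (meson finite_SigmaI finite_subset)+
    have "k * 1 * card E' \<le> k * 1 * card A + k ^ 2 * card B' + card (crossings E')"
    proof (rule card_sampling[OF fin(1) finE' finite_crossings[OF finE'] k,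
          where u = fst and v = "\<lambda>x. fst (fst x)" and w = "\<lambda>x. fst (snd x)"])
      fix A' assume "A' \<subseteq> A"
      have "crossings {e \<in> E'. fst e \<in> A'} =
          {x \<in> crossings E'. fst (fst x) \<in> A' \<and> fst (snd x) \<in> A'}"
        by (auto simp: crossings_def)
      moreover have "{e \<in> E'. fst e \<in> A'} \<subseteq> A' \<times> B'" using that by auto
      ultimately show "1 * card {e \<in> E'. fst e \<in> A'} \<le> 1 * card A' + card B' +
          card {x \<in> crossings E'. fst (fst x) \<in> A' \<and> fst (snd x) \<in> A'}"
        using card_le_crossings[of A' B' "{e \<in> E'. fst e \<in> A'}"] finB' \<open>A' \<subseteq> A\<close> fin
        by (simp add: finite_subset)
    qed (use that in \<open>auto simp: crossings_def\<close>)
    then show ?thesis by simp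
  qed
  have "k * k * card E \<le> k * k ^ 2 * card B + k ^ 2 * (k * card A) + card (crossings E)"
  proof (rule card_sampling[OF fin(2) finE finite_crossings[OF finE] k,
        where u = snd and v = "\<lambda>x. snd (fst x)" and w = "\<lambda>x. snd (snd x)"])
    fix B' assume "B' \<subseteq> B"
    have "crossings {e \<in> E. snd e \<in> B'} =
        {x \<in> crossings E. snd (fst x) \<in> B' \<and> snd (snd x) \<in> B'}"
      by (auto simp: crossings_def)
    moreover have "{e \<in> E. snd e \<in> B'} \<subseteq> A \<times> B'" using E by auto
    ultimately show "k * card {e \<in> E. snd e \<in> B'} \<le> k ^ 2 * card B' + k * card A +
        card {x \<in> crossings E. snd (fst x) \<in> B' \<and> snd (snd x) \<in> B'}"
      using step[of "{e \<in> E. snd e \<in> B'}" B'] \<open>B' \<subseteq> B\<close> by simp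
  qed (use E in \<open>auto simp: crossings_def\<close>)
  then show ?thesis by (simp add: algebra_simps power2_eq_square power3_eq_cube)
qed

text \<open>For each \<open>x\<close> the points \<open>(i, \<phi> i x)\<close> form a pseudoline
  over the columns \<open>0..n\<close>; \<open>single\<close> says that two of them cross at most
  once. A pseudoline meeting \<open>V\<close> in two adjacent columns is an edge in the strip
  between them. The crossing lemma is applied in each strip, and the crossings of all strips belong
  to different ordered pairs from \<open>Q\<close>.\<close>

lemma pseudoline_grid_bound:
  fixes \<phi> :: "nat \<Rightarrow> 'a \<Rightarrow> real"
  assumes fin: "finite Q" "finite V" and k: "k > 0" and n: "n \<ge> 2"
    and single: "\<And>x y h i j. \<lbrakk>x \<in> Q; y \<in> Q; x \<noteq> y; h < i; i < j; j \<le> n\<rbrakk> \<Longrightarrow>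
      \<not> (\<phi> h x \<le> \<phi> h y \<and> \<phi> i y \<le> \<phi> i x \<and> \<phi> j x \<le> \<phi> j y)"
  shows "k ^ 2 * (\<Sum>i<n. card {x \<in> Q. \<phi> i x \<in> V \<and> \<phi> (Suc i) x \<in> V})
    \<le> 2 * n * k ^ 3 * card V + (card Q)\<^sup>2"
proof -
  define S where "S i = {x \<in> Q. \<phi> i x \<in> V \<and> \<phi> (Suc i) x \<in> V}" for i
  define C where "C i = {(x, y). x \<in> Q \<and> y \<in> Q \<and> \<phi> i x < \<phi> i y \<and> \<phi> (Suc i) y < \<phi> (Suc i) x}" for i
  have finC: "finite (C i)" for i
    by (rule finite_subset[of _ "Q \<times> Q"]) (use fin in \<open>auto simp: C_def\<close>)
  have strip: "k ^ 2 * card (S i) \<le> k ^ 3 * (2 * card V) + card (C i)" if i: "i < n" for i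
  proof -
    define e where "e x = (\<phi> i x, \<phi> (Suc i) x)" for x
    \<comment> \<open>If two pseudolines agree in adjacent columns, either order in a third column
      contradicts \<open>single\<close>, whose inequalities are weak. The third column exists
      because \<open>n \<ge> 2\<close>.\<close>
    have inj: "inj_on e Q"
    proof (rule inj_onI, rule ccontr)
      fix x y assume xy: "x \<in> Q" "y \<in> Q" "e x = e y" "x \<noteq> y"
      consider "Suc i < n" | "Suc i = n" "0 < i" using i n by linarith
      then show False
      proof cases
        case 1
        then show ?thesis using single[of x y i "Suc i" n] single[of y x i "Suc i" n] xy
          by (auto simp: e_def)
      next
        case 2
        then show ?thesis using single[of x y 0 i "Suc i"] single[of y x 0 i "Suc i"] xy
          by (auto simp: e_def)
      qed
    qed
    have "card (crossings (e ` S i)) \<le> card (C i)"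
    proof (rule surj_card_le[OF finC])
      show "crossings (e ` S i) \<subseteq> map_prod e e ` C i"
        by (force simp: crossings_def S_def C_def e_def)
    qed
    moreover have "card (e ` S i) = card (S i)"
      by (rule card_image) (use inj in \<open>auto simp: S_def inj_on_def\<close>)
    moreover have "e ` S i \<subseteq> V \<times> V" by (auto simp: e_def S_def)
    ultimately show ?thesis
      using crossing_lemma[OF fin(2,2) _ k, of "e ` S i"] by (simp add: mult_2)
  qed
  have "disjoint_family_on C {..<n}"
    unfolding disjoint_family_on_def
  proof (intro ballI impI)
    \<comment> \<open>To cross twice in the same direction, a pair would have to cross back in
      between.\<close>
    have *: "C i \<inter> C j = {}" if "i < j" "j < n" for i j
    proof -
      have False if "(x, y) \<in> C i" "(x, y) \<in> C j" for x y
        using that single[of x y i "Suc i" j] \<open>i < j\<close> \<open>j < n\<close>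
        by (cases "j = Suc i") (auto simp: C_def)
      then show ?thesis by auto
    qed
    fix i j assume "i \<in> {..<n}" "j \<in> {..<n}" "i \<noteq> j"
    then show "C i \<inter> C j = {}" using *[of i j] *[of j i] by (cases "i < j") auto
  qed
  then have "(\<Sum>i<n. card (C i)) = card (\<Union>i<n. C i)"
    using finC by (intro card_UN_disjoint[symmetric]) (auto simp: disjoint_family_on_def)
  also have "\<dots> \<le> card (Q \<times> Q)"
    by (intro card_mono) (use fin in \<open>auto simp: C_def\<close>)
  finally have "(\<Sum>i<n. card (C i)) \<le> (card Q)\<^sup>2" by (simp add: card_cartesian_product power2_eq_square)
  moreover have "(\<Sum>i<n. k ^ 2 * card (S i)) \<le> (\<Sum>i<n. k ^ 3 * (2 * card V) + card (C i))"
    by (intro sum_mono strip) simp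
  ultimately show ?thesis
    by (simp add: S_def sum.distrib sum_distrib_left algebra_simps)
qed

subsection \<open>Cross ratios\<close>

text \<open>For nonzero \<open>p\<close> and \<open>q\<close> this is the classical cross ratio of
  \<open>a\<close>, \<open>b\<close>, \<open>-1/p\<close>, \<open>-1/q\<close>. It is also the
  factor by which \<open>(1 + b * z) / (1 + a * z)\<close> changes from \<open>z = p\<close> to
  \<open>z = q\<close>.\<close>

definition cross_ratio :: "real \<Rightarrow> real \<Rightarrow> real \<Rightarrow> real \<Rightarrow> real" where
  "cross_ratio a b p q = ((1 + a * p) * (1 + b * q)) / ((1 + a * q) * (1 + b * p))"

lemma one_plus_mult_pos: "0 \<le> a \<Longrightarrow> 0 \<le> b \<Longrightarrow> 0 < 1 + a * b" for a b :: real
  by (simp add: add_pos_nonneg)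

lemma cross_ratio_gt_1:
  assumes "0 \<le> a" "a < b" "0 \<le> p" "p < q"
  shows "cross_ratio a b p q > 1"
proof -
  have "0 < (b - a) * (q - p)" using assms by simp
  then have "(1 + a * q) * (1 + b * p) < (1 + a * p) * (1 + b * q)" by (simp add: algebra_simps)
  moreover have "0 < (1 + a * q) * (1 + b * p)" using assms by (intro mult_pos_pos one_plus_mult_pos) auto
  ultimately show ?thesis by (simp add: cross_ratio_def)
qed

text \<open>The logarithms of the two cross ratios over \<open>[p, q]\<close> are in the ratio of the derivatives of
  \<open>ln ((1 + b z) / (1 + a z))\<close> and \<open>ln ((1 + d z) / (1 + c z))\<close> at some \<open>z \<in> (p, q)\<close>,
  which is strictly monotone in \<open>z\<close>.\<close>

lemma cross_ratio_less:
  assumes y: "0 \<le> a" "a < b" "b \<le> c" "c < d" and z: "0 \<le> p" "p < q" "q \<le> r" "r < s"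
    and le: "cross_ratio a b r s \<le> cross_ratio a b p q"
  shows "cross_ratio c d r s < cross_ratio c d p q"
proof -
  define h where "h u v z = ln (1 + v * z) - ln (1 + u * z)" for u v z :: real
  define h' where "h' u v z = (v - u) / ((1 + u * z) * (1 + v * z))" for u v z :: real
  have ln_cr: "ln (cross_ratio u v x x') = h u v x' - h u v x"
    if "0 \<le> u" "u < v" "0 \<le> x" "x < x'" for u v x x'
  proof -
    have "1 + u * x > 0" "1 + u * x' > 0" "1 + v * x > 0" "1 + v * x' > 0"
      using that by (auto intro: one_plus_mult_pos)
    then show ?thesis by (simp add: cross_ratio_def h_def ln_div ln_mult)
  qed
  have h'_pos: "h' u v x > 0" if "0 \<le> u" "u < v" "0 \<le> x" for u v x
    unfolding h'_def using that by (intro divide_pos_pos mult_pos_pos one_plus_mult_pos) auto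
  have deriv: "(h u v has_real_derivative h' u v x) (at x)" if "0 \<le> u" "u < v" "0 \<le> x" for u v x
  proof -
    have pos: "1 + u * x > 0" "1 + v * x > 0" using that by (auto intro: one_plus_mult_pos)
    show ?thesis
      unfolding h_def[abs_def] h'_def using pos
      by (auto intro!: derivative_eq_intros simp: field_simps)
  qed
  have mvt: "\<exists>w. x < w \<and> w < x' \<and>
      (h a b x' - h a b x) * h' c d w = (h c d x' - h c d x) * h' a b w"
    if "0 \<le> x" "x < x'" for x x'
  proof (rule GMVT'[OF \<open>x < x'\<close>])
    fix w assume "x \<le> w"
    with that y have "0 \<le> a" "a < b" "0 \<le> c" "c < d" "0 \<le> w" by auto
    then show "isCont (h a b) w" "isCont (h c d) w" by (blast intro: DERIV_isCont deriv)+
  next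
    fix w assume "x < w"
    with that y have "0 \<le> a" "a < b" "0 \<le> c" "c < d" "0 \<le> w" by auto
    then show "(h c d has_real_derivative h' c d w) (at w)" "(h a b has_real_derivative h' a b w) (at w)"
      by (blast intro: deriv)+
  qed
  obtain u where u: "p < u" "u < q"
      "(h a b q - h a b p) * h' c d u = (h c d q - h c d p) * h' a b u"
    using mvt[of p q] z by auto
  obtain v where v: "r < v" "v < s"
      "(h a b s - h a b r) * h' c d v = (h c d s - h c d r) * h' a b v"
    using mvt[of r s] z by auto
  have uv: "0 < u" "u < v" using u v z by auto
  \<comment> \<open>\<open>h' c d z / h' a b z\<close> is a constant times
    \<open>(1 + a * z) / (1 + c * z)\<close> times \<open>(1 + b * z) / (1 + d * z)\<close>; both
    quotients decrease because \<open>a < c\<close> and \<open>b < d\<close>.\<close>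
  have ratio: "h' c d v * h' a b u < h' c d u * h' a b v"
  proof -
    have 1: "(1 + a * v) * (1 + c * u) < (1 + a * u) * (1 + c * v)"
      using uv y mult_pos_pos[of "c - a" "v - u"] by (simp add: algebra_simps)
    have 2: "(1 + b * v) * (1 + d * u) < (1 + b * u) * (1 + d * v)"
      using uv y mult_pos_pos[of "d - b" "v - u"] by (simp add: algebra_simps)
    have pos: "0 < 1 + a * u" "0 < 1 + b * u" "0 < 1 + c * u" "0 < 1 + d * u"
      "0 < 1 + a * v" "0 < 1 + b * v" "0 < 1 + c * v" "0 < 1 + d * v"
      using uv y by (auto intro!: one_plus_mult_pos)
    have "((1 + a * v) * (1 + c * u)) * ((1 + b * v) * (1 + d * u))
        < ((1 + a * u) * (1 + c * v)) * ((1 + b * u) * (1 + d * v))"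
      by (rule mult_strict_mono[OF 1 2]) (use pos in auto)
    then have "(d - c) * (b - a) / (((1 + a * u) * (1 + c * v)) * ((1 + b * u) * (1 + d * v)))
        < (d - c) * (b - a) / (((1 + a * v) * (1 + c * u)) * ((1 + b * v) * (1 + d * u)))"
      by (rule divide_strict_left_mono) (use pos y in \<open>auto intro!: mult_pos_pos\<close>)
    then show ?thesis by (simp add: h'_def algebra_simps)
  qed
  have pos: "h' a b u > 0" "h' a b v > 0" "h' c d u > 0" "h' c d v > 0"
    using h'_pos y uv by auto
  define G1 G2 where "G1 = h a b q - h a b p" and "G2 = h a b s - h a b r"
  have cr_pos: "cross_ratio a b r s > 1" "cross_ratio a b p q > 1" "cross_ratio c d r s > 1" "cross_ratio c d p q > 1"
    using y z by (auto intro!: cross_ratio_gt_1)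
  have G: "0 < G2" "G2 \<le> G1"
  proof -
    show "0 < G2" using ln_cr[of a b r s] y z cr_pos by (simp add: G2_def flip: ln_cr)
    show "G2 \<le> G1" using ln_cr[of a b r s] ln_cr[of a b p q] y z cr_pos le
      by (simp add: G1_def G2_def flip: ln_cr)
  qed
  have "h c d s - h c d r = G2 * (h' c d v / h' a b v)"
    using v pos by (simp add: G2_def field_simps)
  also have "\<dots> < G2 * (h' c d u / h' a b u)"
    using ratio pos G by (intro mult_strict_left_mono) (auto simp: field_simps)
  also have "\<dots> \<le> G1 * (h' c d u / h' a b u)"
    using pos G by (intro mult_right_mono) auto
  also have "\<dots> = h c d q - h c d p"
    using u pos by (simp add: G1_def field_simps)
  finally have "ln (cross_ratio c d r s) < ln (cross_ratio c d p q)"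
    using ln_cr y z by simp
  then show ?thesis using cr_pos by simp
qed

lemma ex_initial_segment:
  fixes W :: "'a :: linorder set"
  assumes "finite W" "T \<le> card W"
  shows "\<exists>V\<subseteq>W. card V = T \<and> (\<forall>v\<in>V. \<forall>w\<in>W - V. v < w)"
  using assms(2)
proof (induction T)
  case 0
  show ?case by (intro exI[of _ "{}"]) auto
next
  case (Suc T)
  then obtain V where V: "V \<subseteq> W" "card V = T" "\<forall>v\<in>V. \<forall>w\<in>W - V. v < w" by auto
  have finV: "finite V" using V assms finite_subset by blast
  have "W - V \<noteq> {}" using V Suc.prems by auto
  then have m: "Min (W - V) \<in> W - V" and le: "\<And>w. w \<in> W - V \<Longrightarrow> Min (W - V) \<le> w"
    using assms by (auto intro!: Min_in simp del: Diff_iff)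
  have "card (insert (Min (W - V)) V) = Suc T" using m V finV by simp
  moreover have "\<forall>v\<in>insert (Min (W - V)) V. \<forall>w\<in>W - insert (Min (W - V)) V. v < w"
    using V le by (force simp: less_le)
  ultimately show ?case using m V by (intro exI[of _ "insert (Min (W - V)) V"]) auto
qed

section \<open>The matrix of cross ratios of consecutive terms\<close>

locale nonneg_sequence =
  fixes y :: "nat \<Rightarrow> real" and n :: nat
  assumes nonneg: "0 \<le> y 0" and incr: "\<And>i j. i < j \<Longrightarrow> j \<le> n \<Longrightarrow> y i < y j"
begin

abbreviation cr :: "nat \<Rightarrow> nat \<Rightarrow> real" where
  "cr i j \<equiv> cross_ratio (y i) (y (Suc i)) (y j) (y (Suc j))"

lemma y_nonneg: "i \<le> n \<Longrightarrow> 0 \<le> y i"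
  using nonneg incr[of 0 i] by (cases i) auto

lemma y_mono: "i \<le> j \<Longrightarrow> j \<le> n \<Longrightarrow> y i \<le> y j"
  using incr[of i j] by (cases "i = j") auto

lemma pos: "i \<le> n \<Longrightarrow> j \<le> n \<Longrightarrow> 0 < 1 + y i * y j"
  by (intro one_plus_mult_pos y_nonneg)

lemma cr_gt_1: "i < n \<Longrightarrow> j < n \<Longrightarrow> cr i j > 1"
  by (intro cross_ratio_gt_1 y_nonneg incr) auto

lemma cr_less:
  assumes "i < i'" "i' < n" "j < k" "k < n" "cr i k \<le> cr i j"
  shows "cr i' k < cr i' j"
  by (rule cross_ratio_less[OF _ _ _ _ _ _ _ _ assms(5)]) (use assms in \<open>auto intro!: y_nonneg incr y_mono\<close>)

text \<open>By \<open>cr_less\<close>, once the entry in the left one of two columns is at least the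
  entry in the right one, it is strictly larger in all later rows. So each column, as a function of
  the row, is a pseudoline.\<close>

lemma cr_single_crossing:
  assumes "j < n" "k < n" "j \<noteq> k" "h < i" "i < i'" "i' \<le> n - 1"
  shows "\<not> (cr h j \<le> cr h k \<and> cr i k \<le> cr i j \<and> cr i' j \<le> cr i' k)"
proof -
  have "i < n" "i' < n" using assms by linarith+
  then show ?thesis
    using cr_less[of i i' j k] cr_less[of h i k j] assms by (cases j k rule: linorder_cases) auto
qed

text \<open>By the grid bound only about half of the vertically adjacent pairs of matrix entries lie
  entirely in a small \<open>V\<close>. Every other pair contains an entry outside \<open>V\<close>,
  and an entry lies in at most two pairs.\<close>

lemma card_avoiding:
  assumes "finite V" "16 * card V \<le> n" "n \<ge> 4"
  shows "n ^ 2 \<le> 8 * card {(i, j). i < n \<and> j < n \<and> cr i j \<notin> V}"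
proof -
  define U where "U = {(i, j). i < n \<and> j < n \<and> cr i j \<notin> V}"
  have finU: "finite U" by (rule finite_subset[of _ "{..<n} \<times> {..<n}"]) (auto simp: U_def)
  define S where "S i = {j \<in> {..<n}. cr i j \<in> V \<and> cr (Suc i) j \<in> V}" for i
  \<comment> \<open>The grid bound with \<open>k = 2\<close>; the \<open>n\<close> rows of the
    matrix are the columns of the grid, hence \<open>n - 1\<close> strips.\<close>
  have "2 ^ 2 * (\<Sum>i<n - 1. card (S i)) \<le> 2 * (n - 1) * 2 ^ 3 * card V + (card {..<n})\<^sup>2"
    unfolding S_def using assms cr_single_crossing by (intro pseudoline_grid_bound) auto
  then have "4 * (\<Sum>i<n - 1. card (S i)) \<le> (n - 1) * (16 * card V) + n ^ 2" by (simp add: mult_ac)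
  moreover have "(n - 1) * (16 * card V) \<le> (n - 1) * n" using assms by (intro mult_le_mono2)
  ultimately have S: "4 * (\<Sum>i<n - 1. card (S i)) \<le> (n - 1) * n + n ^ 2" by linarith
  have fin_cover: "finite (Sigma {..<n - 1} S \<union> U \<union> (\<lambda>(i, j). (i - 1, j)) ` U)"
    using finU by (simp add: S_def)
  \<comment> \<open>A pair is indexed by its upper entry, so an avoiding lower entry is shifted from
    \<open>Suc i\<close> to \<open>i\<close>.\<close>
  have cover: "{..<n - 1} \<times> {..<n} \<subseteq> Sigma {..<n - 1} S \<union> U \<union> (\<lambda>(i, j). (i - 1, j)) ` U"
  proof (rule subsetI)
    fix x assume "x \<in> {..<n - 1} \<times> {..<n}"
    then obtain i j where x: "x = (i, j)" "i < n - 1" "j < n" by auto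
    show "x \<in> Sigma {..<n - 1} S \<union> U \<union> (\<lambda>(i, j). (i - 1, j)) ` U"
    proof (cases "(Suc i, j) \<in> U")
      case True
      from imageI[OF this, of "\<lambda>(i, j). (i - 1, j)"] x show ?thesis by simp
    next
      case False
      with x show ?thesis by (auto simp: U_def S_def)
    qed
  qed
  have "(n - 1) * n = card ({..<n - 1} \<times> {..<n})" by simp
  also have "\<dots> \<le> card (Sigma {..<n - 1} S \<union> U \<union> (\<lambda>(i, j). (i - 1, j)) ` U)"
    by (rule card_mono[OF fin_cover cover])
  also have "\<dots> \<le> card (Sigma {..<n - 1} S) + card U + card U"
    using card_Un_le[of "Sigma {..<n - 1} S \<union> U" "(\<lambda>(i, j). (i - 1, j)) ` U"]
      card_Un_le[of "Sigma {..<n - 1} S" U] card_image_le[OF finU, of "\<lambda>(i, j). (i - 1, j)"] by linarith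
  finally have "(n - 1) * n \<le> (\<Sum>i<n - 1. card (S i)) + 2 * card U"
    by (simp add: S_def)
  with S have "3 * ((n - 1) * n) \<le> n ^ 2 + 8 * card U" by linarith
  moreover have "2 * n ^ 2 \<le> 3 * ((n - 1) * n)"
    using mult_le_mono1[of "2 * n" "3 * (n - 1)" n] \<open>n \<ge> 4\<close> by (simp add: power2_eq_square)
  ultimately show ?thesis by (simp add: U_def)
qed

text \<open>The alternating product of the edge weights \<open>1 + u * v\<close> along the nine-edge
  walk in \<open>card_Y_cube\<close>: three edges give the first two factors, four the cross ratio,
  and two cancel.\<close>

definition walk_value :: "nat \<times> nat \<times> nat \<times> nat \<Rightarrow> real" where
  "walk_value = (\<lambda>(i, j, i', j').
     (1 + y n * y i) * ((1 + y (Suc i) * y j) / (1 + y i * y j)) * cr i' j')"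

text \<open>Between the consecutive numbers \<open>1 + y n * y i\<close> lie the numbers obtained by multiplying with
  \<open>(1 + y (Suc i) * y j) / (1 + y i * y j)\<close>, and between two consecutive ones of these lie all
  their multiples by cross ratios less than \<open>cr i j\<close>.\<close>

lemma ex_many_walk_values:
  assumes "n \<ge> 16"
  shows "\<exists>G \<subseteq> {..<n} \<times> {..<n} \<times> {..<n} \<times> {..<n}. inj_on walk_value G \<and> n ^ 3 \<le> 256 * card G"
proof -
  \<comment> \<open>The largest size of \<open>V\<close> that \<open>card_avoiding\<close>
    admits.\<close>
  define T where "T = n div 16"
  define W where "W = (\<lambda>(i, j). cr i j) ` ({..<n} \<times> {..<n})"
  have finW: "finite W" by (simp add: W_def)
  \<comment> \<open>With fewer than \<open>T\<close> cross ratios in all, some entry would avoid the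
    set of all entries.\<close>
  have "T \<le> card W"
  proof (rule ccontr)
    assume "\<not> T \<le> card W"
    then have "n ^ 2 \<le> 8 * card {(i, j). i < n \<and> j < n \<and> cr i j \<notin> W}"
      by (intro card_avoiding finW) (use assms in \<open>auto simp: T_def\<close>)
    also have "{(i, j). i < n \<and> j < n \<and> cr i j \<notin> W} = {}" by (auto simp: W_def)
    finally show False using assms by simp
  qed
  then obtain V where V: "V \<subseteq> W" "card V = T" "\<And>v w. v \<in> V \<Longrightarrow> w \<in> W - V \<Longrightarrow> v < w"
    using ex_initial_segment[OF finW] by metis
  have finV: "finite V" using V finW finite_subset by blast
  \<comment> \<open>\<open>V\<close> consists of the \<open>T\<close> smallest cross ratios, so the
    entries at positions in \<open>U\<close> exceed all elements of \<open>V\<close>.\<close>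
  define U where "U = {(i, j). i < n \<and> j < n \<and> cr i j \<notin> V}"
  have U: "n ^ 2 \<le> 8 * card U"
    unfolding U_def by (rule card_avoiding[OF finV]) (use V assms in \<open>auto simp: T_def\<close>)
  have "\<forall>v\<in>V. \<exists>x. fst x < n \<and> snd x < n \<and> cr (fst x) (snd x) = v" using V(1) by (force simp: W_def)
  then obtain r where r: "\<And>v. v \<in> V \<Longrightarrow> fst (r v) < n \<and> snd (r v) < n \<and> cr (fst (r v)) (snd (r v)) = v"
    by metis
  define B where "B i = 1 + y n * y i" for i
  define g where "g i j = B i * ((1 + y (Suc i) * y j) / (1 + y i * y j))" for i j
  have B_pos: "B i > 0" if "i \<le> n" for i unfolding B_def using that by (intro pos) auto
  have g_pos: "g i j > 0" if "i < n" "j \<le> n" for i j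
    unfolding g_def using that B_pos by (intro mult_pos_pos divide_pos_pos pos) auto
  have g_cr: "g i (Suc j) = g i j * cr i j" if "i < n" "j < n" for i j
    using pos[of i j] pos[of i "Suc j"] pos[of "Suc i" j] pos[of "Suc i" "Suc j"] that
    by (simp add: g_def cross_ratio_def)
  have g_mono: "g i j \<le> g i j'" if "j \<le> j'" "j' \<le> n" "i < n" for i j j'
    using that
  proof (induction j' rule: dec_induct)
    case (step k)
    then have "g i j * 1 \<le> g i k * cr i k"
      using g_pos[of i k] cr_gt_1[of i k] by (intro mult_mono) auto
    then show ?case using step by (simp add: g_cr)
  qed simp
  have g_0: "B i \<le> g i 0" if "i < n" for i
  proof -
    have "y i * y 0 \<le> y (Suc i) * y 0" using that by (intro mult_right_mono y_mono nonneg) auto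
    then have "1 \<le> (1 + y (Suc i) * y 0) / (1 + y i * y 0)"
      using pos[of i 0] that by simp
    then have "B i * 1 \<le> g i 0" unfolding g_def using B_pos[of i] that by (intro mult_left_mono) auto
    then show ?thesis by simp
  qed
  \<comment> \<open>This is why the walk starts at \<open>y n\<close>: taking \<open>j = n\<close>
    turns \<open>B i\<close> into exactly \<open>B (Suc i)\<close>, so the blocks for successive
    \<open>i\<close> do not overlap.\<close>
  have g_n: "g i n = B (Suc i)" if "i < n" for i
    using pos[of i n] that by (simp add: g_def B_def mult.commute)
  have B_mono: "B i \<le> B j" if "i \<le> j" "j \<le> n" for i j
    unfolding B_def using that y_mono y_nonneg by (simp add: mult_left_mono)
  have between: "g i j < g i j * v \<and> g i j * v < g i (Suc j)" if "(i, j) \<in> U" "v \<in> V" for i j v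
  proof -
    have ij: "i < n" "j < n" "cr i j \<in> W - V" using that by (auto simp: U_def W_def)
    then have "v < cr i j" using V(3) that by blast
    moreover have "v > 1" using r[OF \<open>v \<in> V\<close>] cr_gt_1 by metis
    ultimately show ?thesis using g_pos[of i j] ij by (simp add: g_cr)
  qed
  have less: "g i j * v < g i' j' * v'"
    if "(i, j) \<in> U" "(i', j') \<in> U" "v \<in> V" "v' \<in> V" "i < i' \<or> i = i' \<and> j < j'" for i j v i' j' v'
  proof -
    have lt: "i < n" "j < n" "i' < n" "j' < n" using that by (auto simp: U_def)
    have "g i (Suc j) \<le> g i' j'"
    proof (cases "i = i'")
      case True
      then have "Suc j \<le> j'" using that(5) by simp
      then show ?thesis using g_mono[of "Suc j" j' i] True lt by simp
    next
      case False
      have "g i (Suc j) \<le> B (Suc i)" using g_mono[of "Suc j" n i] g_n[of i] lt by simp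
      also have "\<dots> \<le> B i'" using False that lt by (intro B_mono) auto
      also have "\<dots> \<le> g i' 0" using lt by (intro g_0)
      also have "\<dots> \<le> g i' j'" using lt by (intro g_mono) auto
      finally show ?thesis .
    qed
    with between[OF that(1,3)] between[OF that(2,4)] show ?thesis by linarith
  qed
  have inj: "inj_on (\<lambda>x. g (fst (fst x)) (snd (fst x)) * snd x) (U \<times> V)"
  proof (rule inj_onI)
    fix x x' assume x: "x \<in> U \<times> V" "x' \<in> U \<times> V"
      and eq': "g (fst (fst x)) (snd (fst x)) * snd x = g (fst (fst x')) (snd (fst x')) * snd x'"
    obtain i j v where ijv: "x = ((i, j), v)" by (metis surj_pair)
    obtain i' j' v' where ijv': "x' = ((i', j'), v')" by (metis surj_pair)
    have *: "(i, j) \<in> U" "v \<in> V" "(i', j') \<in> U" "v' \<in> V" and eq: "g i j * v = g i' j' * v'"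
      using x eq' by (auto simp: ijv ijv')
    have "\<not> (i < i' \<or> i = i' \<and> j < j')" "\<not> (i' < i \<or> i' = i \<and> j' < j)"
      using less[of i j i' j' v v'] less[of i' j' i j v' v] * eq by auto
    then have "i = i'" "j = j'" by auto
    moreover have "g i j \<noteq> 0" using g_pos[of i j] * by (auto simp: U_def)
    ultimately show "x = x'" using eq by (simp add: ijv ijv')
  qed
  define F where "F x = (fst (fst x), snd (fst x), r (snd x))" for x :: "(nat \<times> nat) \<times> real"
  have wv: "walk_value (F x) = g (fst (fst x)) (snd (fst x)) * snd x" if "x \<in> U \<times> V" for x
    using that r by (auto simp: F_def walk_value_def g_def B_def split_beta)
  have "inj_on (walk_value \<circ> F) (U \<times> V)"
    using inj wv by (simp add: inj_on_def)
  then have "inj_on F (U \<times> V)" "inj_on walk_value (F ` (U \<times> V))"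
    by (auto intro: inj_on_imageI2 inj_on_imageI simp: comp_def)
  moreover have "F ` (U \<times> V) \<subseteq> {..<n} \<times> {..<n} \<times> {..<n} \<times> {..<n}"
    using r by (intro image_subsetI) (simp add: F_def U_def mem_Times_iff case_prod_beta)
  \<comment> \<open>The constant is 8 from \<open>card_avoiding\<close> times 32 from
    \<open>n \<le> 32 * T\<close>.\<close>
  moreover have "n ^ 3 \<le> 256 * (card U * card V)"
  proof -
    have "1 \<le> T" using div_le_mono[OF assms, of 16] by (simp add: T_def)
    then have "n \<le> 32 * T"
      using div_mult_mod_eq[of n 16] mod_less_divisor[of 16 n] unfolding T_def by linarith
    then have "n ^ 2 * n \<le> (8 * card U) * (32 * T)" using U by (intro mult_le_mono)
    then show ?thesis using V(2) by (simp add: power2_eq_square power3_eq_cube)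
  qed
  ultimately show ?thesis
    by (intro exI[of _ "F ` (U \<times> V)"]) (simp add: card_image card_cartesian_product)
qed

end

subsection \<open>Walks\<close>

text \<open>Unfolded, the entries in odd positions divided by those in even positions;
  \<open>alt_walk\<close> is the same for the edge weights of a walk.\<close>

fun alt_prod :: "real list \<Rightarrow> real" where
  "alt_prod [] = 1"
| "alt_prod (x # xs) = x / alt_prod xs"

fun alt_walk :: "real list \<Rightarrow> real" where
  "alt_walk (u # v # ws) = (1 + u * v) / alt_walk (v # ws)"
| "alt_walk _ = 1"

text \<open>A pair of \<open>y\<close> and \<open>r \<in> X y\<close> stands for the point
  \<open>r * (1, y)\<close>, and \<open>L\<close> contains all dot products. \<open>X_one\<close> is
  the normalisation that every ray meets the line with first coordinate 1.\<close>

locale radii =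
  fixes Y :: "real set" and X :: "real \<Rightarrow> real set" and L :: "real set" and a :: nat
  assumes Y_nonneg: "\<And>y. y \<in> Y \<Longrightarrow> 0 \<le> y"
    and X_pos: "\<And>y r. y \<in> Y \<Longrightarrow> r \<in> X y \<Longrightarrow> 0 < r"
    and X_finite: "\<And>y. y \<in> Y \<Longrightarrow> finite (X y)"
    and X_one: "\<And>y. y \<in> Y \<Longrightarrow> 1 \<in> X y"
    and X_card: "\<And>y. y \<in> Y \<Longrightarrow> a \<le> card (X y)"
    and L_finite: "finite L"
    and mem_L: "\<And>y z r s. \<lbrakk>y \<in> Y; z \<in> Y; r \<in> X y; s \<in> X z\<rbrakk> \<Longrightarrow> (1 + y * z) * r * s \<in> L"
begin

lemma one_plus_pos: "y \<in> Y \<Longrightarrow> z \<in> Y \<Longrightarrow> 0 < 1 + y * z"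
  by (intro one_plus_mult_pos Y_nonneg)

text \<open>Each interior vertex \<open>v\<close> of the walk is given a radius from \<open>X v\<close>, the first vertex gets the
  radius \<open>r\<close> and the last one the radius 1. The dot products along the edges form the list.\<close>

fun walk_products :: "real \<Rightarrow> real list \<Rightarrow> real list set" where
  "walk_products r (u # v # w # ws) =
     (\<lambda>(s, l). ((1 + u * v) * r * s) # l) ` Sigma (X v) (\<lambda>s. walk_products s (v # w # ws))"
| "walk_products r [u, v] = {[(1 + u * v) * r]}"
| "walk_products r _ = {}"

text \<open>The radius of an interior vertex enters two consecutive edges and cancels. Hence a list
  of products determines the value of its walk.\<close>

lemma alt_prod_walk_products:
  "\<lbrakk>l \<in> walk_products r ws; set ws \<subseteq> Y\<rbrakk> \<Longrightarrow> alt_prod l = r * alt_walk ws"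
proof (induction r ws arbitrary: l rule: walk_products.induct)
  case (1 r u v w ws)
  from 1(2) obtain s l' where l: "s \<in> X v" "l' \<in> walk_products s (v # w # ws)" "l = ((1 + u * v) * r * s) # l'"
    by auto
  have "0 < s" using l(1) X_pos 1(3) by auto
  moreover have "alt_prod l' = s * alt_walk (v # w # ws)" using 1(1)[OF l(2)] 1(3) by simp
  ultimately show ?case unfolding l(3) alt_prod.simps alt_walk.simps(1)[of u] by simp
qed auto

lemma walk_products_subset:
  "\<lbrakk>l \<in> walk_products r ws; set ws \<subseteq> Y; r \<in> X (hd ws)\<rbrakk> \<Longrightarrow> set l \<subseteq> L \<and> length l = length ws - 1"
proof (induction r ws arbitrary: l rule: walk_products.induct)
  case (1 r u v w ws)
  from 1(2) obtain s l' where l: "s \<in> X v" "l' \<in> walk_products s (v # w # ws)" "l = ((1 + u * v) * r * s) # l'"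
    by auto
  have "(1 + u * v) * r * s \<in> L" using l(1) 1(3,4) by (intro mem_L) auto
  then show ?case using 1(1)[OF l(2)] 1(3) l(1,3) by simp
next
  case (2 r u v)
  then show ?case using mem_L[of u v r 1] X_one[of v] by simp
qed auto

text \<open>The first product determines the radius of the next vertex, so each interior vertex
  contributes a factor of at least \<open>a\<close>.\<close>

lemma card_walk_products:
  "\<lbrakk>set ws \<subseteq> Y; 2 \<le> length ws; 0 < r\<rbrakk> \<Longrightarrow>
    finite (walk_products r ws) \<and> a ^ (length ws - 2) \<le> card (walk_products r ws)"
proof (induction r ws rule: walk_products.induct)
  case (1 r u v w ws)
  have IH: "finite (walk_products s (v # w # ws)) \<and> a ^ length ws \<le> card (walk_products s (v # w # ws))"
    if "s \<in> X v" for s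
    using 1(1)[of s] 1(2) X_pos[of v s] that by auto
  have "inj_on (\<lambda>(s, l). ((1 + u * v) * r * s) # l) (Sigma (X v) (\<lambda>s. walk_products s (v # w # ws)))"
    using one_plus_pos[of u v] 1(2,4) by (auto simp: inj_on_def)
  then have "card (walk_products r (u # v # w # ws)) = (\<Sum>s\<in>X v. card (walk_products s (v # w # ws)))"
    using X_finite[of v] 1(2) IH by (simp add: card_image card_SigmaI)
  also have "\<dots> \<ge> (\<Sum>s\<in>X v. a ^ length ws)"
    using IH by (intro sum_mono) blast
  finally have "card (X v) * a ^ length ws \<le> card (walk_products r (u # v # w # ws))"
    by simp
  moreover have "a * a ^ length ws \<le> card (X v) * a ^ length ws"
    using X_card[of v] 1(2) by (intro mult_le_mono1) auto
  moreover have "a ^ (length (u # v # w # ws) - 2) = a * a ^ length ws" by simp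
  ultimately have "a ^ (length (u # v # w # ws) - 2) \<le> card (walk_products r (u # v # w # ws))"
    by linarith
  moreover have "finite (walk_products r (u # v # w # ws))"
    using IH X_finite[of v] 1(2) by auto
  ultimately show ?case by blast
qed auto

text \<open>Walks with different values have disjoint sets of lists; each set has at least
  \<open>a ^ k\<close> members, and all are lists of length \<open>k + 1\<close> over
  \<open>L\<close>.\<close>

lemma card_walks:
  assumes W: "finite W" "\<And>w. w \<in> W \<Longrightarrow> set w \<subseteq> Y \<and> length w = Suc (Suc k)"
    and inj: "inj_on alt_walk W"
  shows "card W * a ^ k \<le> card L ^ Suc k"
proof -
  have wp: "finite (walk_products 1 w) \<and> a ^ k \<le> card (walk_products 1 w)" if "w \<in> W" for w
    using card_walk_products[of w 1] W(2)[OF that] by simp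
  have "card W * a ^ k = (\<Sum>w\<in>W. a ^ k)" by simp
  also have "\<dots> \<le> (\<Sum>w\<in>W. card (walk_products 1 w))" using wp by (intro sum_mono) blast
  also have "\<dots> = card (\<Union>w\<in>W. walk_products 1 w)"
  proof (rule card_UN_disjoint[symmetric])
    have False if "w \<in> W" "w' \<in> W" "w \<noteq> w'" "l \<in> walk_products 1 w" "l \<in> walk_products 1 w'" for w w' l
      using that alt_prod_walk_products[of l 1 w] alt_prod_walk_products[of l 1 w'] W(2) inj
      by (auto dest: inj_onD)
    then show "\<forall>w\<in>W. \<forall>w'\<in>W. w \<noteq> w' \<longrightarrow> walk_products 1 w \<inter> walk_products 1 w' = {}"
      by blast
  qed (use W wp in auto)
  also have "\<dots> \<le> card {l. set l \<subseteq> L \<and> length l = Suc k}"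
  proof (rule card_mono)
    have "set l \<subseteq> L \<and> length l = Suc k" if "w \<in> W" "l \<in> walk_products 1 w" for w l
    proof -
      have "hd w \<in> Y" using W(2)[OF \<open>w \<in> W\<close>] by (cases w) auto
      then show ?thesis using walk_products_subset[OF that(2)] W(2)[OF \<open>w \<in> W\<close>] X_one by simp
    qed
    then show "(\<Union>w\<in>W. walk_products 1 w) \<subseteq> {l. set l \<subseteq> L \<and> length l = Suc k}" by blast
  qed (use L_finite finite_lists_length_eq in blast)
  also have "\<dots> = card L ^ Suc k" using card_lists_length_eq[OF L_finite] by simp
  finally show ?thesis .
qed

lemma card_le_L:
  assumes "y \<in> Y"
  shows "a \<le> card L" "1 \<le> card L"
proof -
  have "card (X y) \<le> card L"
    by (rule card_inj_on_le[of "\<lambda>r. (1 + y * y) * r * 1"])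
       (use one_plus_pos[OF assms assms] mem_L[OF assms assms _ X_one[OF assms]] L_finite in \<open>auto simp: inj_on_def\<close>)
  then show "a \<le> card L" using X_card[OF assms] by simp
  have "L \<noteq> {}" using mem_L[OF assms assms X_one[OF assms] X_one[OF assms]] by auto
  then show "1 \<le> card L" using L_finite by (simp add: card_gt_0_iff Suc_le_eq)
qed

text \<open>The walk runs twice through the edge from \<open>y (Suc i)\<close> to \<open>y j'\<close>, with opposite signs, in
  order to connect the first three edges with the four edges of the cross ratio.\<close>

lemma card_Y_cube:
  assumes finY: "finite Y" and "Y \<noteq> {}"
  shows "card Y ^ 3 * a ^ 8 \<le> 4913 * card L ^ 9"
proof (cases "card Y \<le> 16")
  \<comment> \<open>For small \<open>Y\<close> the bounds \<open>a \<le> card L\<close> and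
    \<open>1 \<le> card L\<close> suffice, as 4913 exceeds \<open>16 ^ 3\<close>.\<close>
  case True
  obtain u where "u \<in> Y" using assms by auto
  from card_le_L[OF this] have "a ^ 8 \<le> card L ^ 9"
    by (intro order_trans[OF power_mono power_increasing]) auto
  moreover have "card Y ^ 3 \<le> 16 ^ 3" using True by (intro power_mono) auto
  ultimately have "card Y ^ 3 * a ^ 8 \<le> 16 ^ 3 * card L ^ 9" by (intro mult_le_mono) auto
  then show ?thesis by simp
next
  case False
  define y where "y i = sorted_list_of_set Y ! i" for i
  define n where "n = card Y - 1"
  have n: "n \<ge> 16" "card Y = Suc n" using False by (auto simp: n_def)
  have y_mem: "y i \<in> Y" if "i \<le> n" for i
    using that n finY nth_mem[of i "sorted_list_of_set Y"] by (simp add: y_def)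
  have "y i < y j" if "i < j" "j \<le> n" for i j
    using that n finY unfolding y_def
    by (intro sorted_wrt_nth_less[OF strict_sorted_list_of_set]) auto
  then interpret nonneg_sequence y n
    using y_mem[of 0] Y_nonneg by unfold_locales auto
  obtain G where G: "G \<subseteq> {..<n} \<times> {..<n} \<times> {..<n} \<times> {..<n}" "inj_on walk_value G" "n ^ 3 \<le> 256 * card G"
    using ex_many_walk_values n by blast
  define walk where "walk = (\<lambda>(i, j, i', j'). [y n, y i, y j, y (Suc i), y j', y i', y (Suc j'), y (Suc i'), y j', y (Suc i)])"
  have finG: "finite G" using G(1) finite_subset by blast
  have alt: "alt_walk (walk g) = walk_value g" if "g \<in> G" for g
  proof -
    obtain i j i' j' where g: "g = (i, j, i', j')" by (metis surj_pair)
    then have lt: "i < n" "j < n" "i' < n" "j' < n" using that G(1) by auto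
    have "0 < 1 + y k * y k'" if "k \<in> {i, j, i', j', Suc i, Suc i', Suc j'}" "k' \<in> {i, j, i', j', Suc i, Suc i', Suc j'}" for k k'
      using that lt by (intro pos) auto
    then have "1 + y i * y j \<noteq> 0" "1 + y j * y (Suc i) \<noteq> 0" "1 + y (Suc i) * y j' \<noteq> 0" "1 + y j' * y i' \<noteq> 0"
      "1 + y i' * y (Suc j') \<noteq> 0" "1 + y (Suc j') * y (Suc i') \<noteq> 0" "1 + y (Suc i') * y j' \<noteq> 0"
      by (metis insertCI less_irrefl)+
    then show ?thesis
      by (simp add: g walk_def walk_value_def cross_ratio_def mult.commute)
  qed
  have "inj_on (alt_walk \<circ> walk) G" using G(2) alt by (simp add: inj_on_def)
  then have inj: "inj_on alt_walk (walk ` G)" "inj_on walk G"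
    by (auto intro: inj_on_imageI inj_on_imageI2)
  have "card (walk ` G) * a ^ 8 \<le> card L ^ Suc 8"
  proof (rule card_walks[OF _ _ inj(1)])
    fix w assume "w \<in> walk ` G"
    then obtain i j i' j' where "(i, j, i', j') \<in> G" "w = walk (i, j, i', j')" by (metis imageE surj_pair)
    then show "set w \<subseteq> Y \<and> length w = Suc (Suc 8)"
      using G(1) by (force simp: walk_def intro!: y_mem)
  qed (use finG in auto)
  then have G': "card G * a ^ 8 \<le> card L ^ 9" by (simp add: card_image[OF inj(2)])
  have "card Y ^ 3 \<le> (2 * n) ^ 3" using n by (intro power_mono) auto
  then have "card Y ^ 3 \<le> 2048 * card G" using G(3) by (simp add: power_mult_distrib)
  then have "card Y ^ 3 * a ^ 8 \<le> 2048 * card G * a ^ 8" by (rule mult_le_mono1)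
  then show ?thesis using G' by linarith
qed

end

subsection \<open>Point sets\<close>

text \<open>In decreasing order the \<open>i\<close>-th weight is at most
  \<open>A / i powr s\<close>, and the sum of these is compared with the integral of
  \<open>x powr (- s)\<close>. The induction removes a smallest weight.\<close>

lemma sum_le_powr_card:
  fixes w :: "'a \<Rightarrow> real" and s A :: real
  assumes "finite S" "0 < s" "s < 1" "0 \<le> A"
    and "\<And>x. x \<in> S \<Longrightarrow> 0 \<le> w x"
    and "\<And>x. x \<in> S \<Longrightarrow> w x * real (card {y \<in> S. w x \<le> w y}) powr s \<le> A"
  shows "sum w S \<le> A / (1 - s) * real (card S) powr (1 - s)"
  using assms(1,5,6)
proof (induction "card S" arbitrary: S)
  case 0
  then show ?case by simp
next
  case (Suc n)
  then have "S \<noteq> {}" by auto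
  with Suc.prems(1) obtain x where x: "x \<in> S" "\<And>y. y \<in> S \<Longrightarrow> w x \<le> w y"
    by (metis (no_types, lifting) arg_min_if_finite(1) arg_min_least)
  define N where "N = real (card S)"
  have N: "N = real n + 1" using Suc.hyps(2) by (simp add: N_def flip: Suc.hyps)
  have "{y \<in> S. w x \<le> w y} = S" using x by auto
  with Suc.prems(3)[OF x(1)] have wx: "w x * N powr s \<le> A" by (simp add: N_def)
  have card': "card (S - {x}) = n" using Suc.hyps(2) x(1) Suc.prems(1) by simp
  have IH: "sum w (S - {x}) \<le> A / (1 - s) * real n powr (1 - s)"
  proof (subst card'[symmetric], rule Suc.hyps(1))
    fix y assume y: "y \<in> S - {x}"
    have "w y * real (card {z \<in> S - {x}. w y \<le> w z}) powr s \<le> w y * real (card {z \<in> S. w y \<le> w z}) powr s"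
      using Suc.prems(1,2) y assms(2)
      by (intro mult_left_mono powr_mono2 of_nat_mono card_mono) auto
    then show "w y * real (card {z \<in> S - {x}. w y \<le> w z}) powr s \<le> A"
      using Suc.prems(3)[of y] y by simp
  qed (use Suc.prems card' in auto)
  \<comment> \<open>The increment of the integral bound from \<open>n\<close> to
    \<open>N = n + 1\<close>, multiplied by \<open>N powr s\<close>; it is weighted AM-GM.\<close>
  have young: "(1 - s) + real n powr (1 - s) * N powr s \<le> N"
  proof (cases "n = 0")
    case True
    then show ?thesis using N assms by simp
  next
    case False
    then have "real n powr (1 - s) * N powr s \<le> (1 - s) * real n + s * N"
      using assms N by (intro Youngs_inequality_0) auto
    then show ?thesis using N by (simp add: algebra_simps)
  qed
  have Npos: "N powr s > 0" using N by simp
  have "sum w S = w x + sum w (S - {x})" using x(1) Suc.prems(1) by (simp add: sum.remove)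
  also have "\<dots> \<le> A / N powr s + A / (1 - s) * real n powr (1 - s)"
    using wx IH Npos by (intro add_mono) (auto simp: field_simps)
  also have "\<dots> = A / (1 - s) / N powr s * ((1 - s) + real n powr (1 - s) * N powr s)"
    using Npos assms by (simp add: field_simps)
  also have "\<dots> \<le> A / (1 - s) / N powr s * N"
    using young Npos assms by (intro mult_left_mono) auto
  also have "\<dots> = A / (1 - s) * N powr (1 - s)"
    using N by (simp add: powr_diff)
  finally show ?case by (simp add: N_def)
qed

lemma same_signs:
  fixes a b x y :: real
  assumes "0 < a" "0 < b" "a * x = b * y"
  shows "x \<le> 0 \<longleftrightarrow> y \<le> 0" "0 \<le> x \<longleftrightarrow> 0 \<le> y"
proof -
  obtain c where "c > 0" "x = c * y"
    using assms by (intro that[of "b / a"]) (auto simp: field_simps)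
  then show "x \<le> 0 \<longleftrightarrow> y \<le> 0" "0 \<le> x \<longleftrightarrow> 0 \<le> y"
    by (auto simp: mult_le_0_iff zero_le_mult_iff)
qed

lemma angular_sector_inner_pos:
  assumes "P \<subseteq> angular_sector \<alpha> \<phi>" "\<phi> < pi / 2" "0 \<notin> P" "x \<in> P" "y \<in> P"
  shows "0 < x \<bullet> y"
proof -
  obtain r \<theta> where x: "x = vector [r * cos \<theta>, r * sin \<theta>]" "0 \<le> r" "\<alpha> \<le> \<theta>" "\<theta> \<le> \<alpha> + \<phi>"
    using assms(1,4) by (force simp: angular_sector_def)
  obtain r' \<theta>' where y: "y = vector [r' * cos \<theta>', r' * sin \<theta>']" "0 \<le> r'" "\<alpha> \<le> \<theta>'" "\<theta>' \<le> \<alpha> + \<phi>"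
    using assms(1,5) by (force simp: angular_sector_def)
  have "r \<noteq> 0" "r' \<noteq> 0"
  proof -
    have "vector [0, 0] = (0 :: real^2)" by (simp add: vec_eq_iff forall_2)
    then show "r \<noteq> 0" "r' \<noteq> 0" using x(1) y(1) assms(3,4,5) by auto
  qed
  moreover have "0 < cos (\<theta> - \<theta>')" using x y assms(2) by (intro cos_gt_zero_pi) auto
  moreover have "x \<bullet> y = r * r' * cos (\<theta> - \<theta>')"
    unfolding x(1) y(1) by (simp add: inner_vec_def sum_2 cos_diff algebra_simps)
  ultimately show ?thesis using x(2) y(2) by simp
qed

section \<open>Coordinates along and across the pin\<close>

locale acute_set =
  fixes P :: "(real^2) set" and p :: "real^2"
  assumes finite_P: "finite P" and p_in_P: "p \<in> P"
    and inner_pos: "\<And>x y. x \<in> P \<Longrightarrow> y \<in> P \<Longrightarrow> 0 < x \<bullet> y"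
begin

definition along :: "real^2 \<Rightarrow> real" where "along x = p \<bullet> x"

text \<open>The determinant of \<open>p\<close> and \<open>x\<close>, that is, the inner product of
  \<open>x\<close> with \<open>p\<close> turned by a right angle. Both coordinates are orthonormal
  ones scaled by the norm of \<open>p\<close>.\<close>

definition across :: "real^2 \<Rightarrow> real" where "across x = p $ 1 * x $ 2 - p $ 2 * x $ 1"

definition slope :: "real^2 \<Rightarrow> real" where "slope x = across x / along x"

abbreviation fiber :: "real \<Rightarrow> (real^2) set" where "fiber \<sigma> \<equiv> {x \<in> P. slope x = \<sigma>}"

lemma pp_pos: "0 < p \<bullet> p"
  using inner_pos p_in_P by blast

lemma along_pos: "x \<in> P \<Longrightarrow> 0 < along x"
  using inner_pos p_in_P by (simp add: along_def)

lemma inner_eq: "(p \<bullet> p) * (x \<bullet> y) = along x * along y + across x * across y"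
  by (simp add: along_def across_def inner_vec_def sum_2 algebra_simps)

lemma across_eq: "x \<in> P \<Longrightarrow> across x = slope x * along x"
  using along_pos[of x] by (simp add: slope_def)

lemma inner_eq_slope:
  "x \<in> P \<Longrightarrow> y \<in> P \<Longrightarrow> (p \<bullet> p) * (x \<bullet> y) = along x * along y * (1 + slope x * slope y)"
  by (simp add: inner_eq across_eq algebra_simps)

lemma along_diff: "along (x - y) = along x - along y"
  and across_diff: "across (x - y) = across x - across y"
  and along_scale: "along (c *\<^sub>R x) = c * along x"
  and across_scale: "across (c *\<^sub>R x) = c * across x"
  by (simp_all add: along_def across_def inner_diff_right algebra_simps)

lemma eq_zeroI:
  assumes "along x = 0" "across x = 0"
  shows "x = 0"
proof -
  have "(p \<bullet> p) * (x \<bullet> x) = 0" using assms by (simp add: inner_eq)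
  then show ?thesis using pp_pos by simp
qed

lemma eqI: "along x = along y \<Longrightarrow> across x = across y \<Longrightarrow> x = y"
  using eq_zeroI[of "x - y"] by (simp add: along_diff across_diff)

section \<open>Occupied rays as level sets of the slope\<close>

definition ray_of :: "real \<Rightarrow> (real^2) set" where
  "ray_of \<sigma> = {x. 0 < along x \<and> across x = \<sigma> * along x}"

lemma ray_eq:
  assumes "0 < along x"
  shows "{s *\<^sub>R x |s. s > 0} = ray_of (slope x)"
proof (intro equalityI subsetI)
  fix y assume "y \<in> ray_of (slope x)"
  then have "0 < along y / along x" "y = (along y / along x) *\<^sub>R x"
    using assms by (auto intro!: eqI simp: along_scale across_scale ray_of_def slope_def)
  then show "y \<in> {s *\<^sub>R x |s. s > 0}" by blast
qed (use assms in \<open>auto simp: ray_of_def along_scale across_scale slope_def\<close>)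

lemma Int_ray_of: "P \<inter> ray_of \<sigma> = fiber \<sigma>"
proof -
  have "x \<in> ray_of \<sigma> \<longleftrightarrow> slope x = \<sigma>" if "x \<in> P" for x
    using along_pos[OF that] by (auto simp: ray_of_def slope_def field_simps)
  then show ?thesis by auto
qed

lemma occupied_rays_eq: "occupied_rays P = ray_of ` slope ` P"
proof (intro equalityI subsetI)
  fix R assume "R \<in> occupied_rays P"
  then obtain u x where u: "R = {s *\<^sub>R u |s. s > 0}" "x \<in> R" "x \<in> P"
    by (auto simp: occupied_rays_def is_ray_def)
  then obtain s where s: "s > 0" "x = s *\<^sub>R u" by auto
  have "0 < along u" using along_pos[OF u(3)] s by (simp add: along_scale zero_less_mult_iff)
  moreover from this have "slope u = slope x" using s by (simp add: slope_def along_scale across_scale)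
  ultimately show "R \<in> ray_of ` slope ` P" using u ray_eq by auto
next
  fix R assume "R \<in> ray_of ` slope ` P"
  then obtain x where x: "x \<in> P" "R = ray_of (slope x)" by auto
  have "R = {s *\<^sub>R x |s. s > 0}" using x ray_eq along_pos by simp
  moreover have "x \<noteq> 0" using inner_pos[OF x(1) x(1)] by auto
  moreover have "x \<in> R \<inter> P" using x Int_ray_of[of "slope x"] by blast
  ultimately show "R \<in> occupied_rays P" unfolding occupied_rays_def is_ray_def by blast
qed

lemma inj_ray_of: "inj_on ray_of (slope ` P)"
proof (rule inj_onI)
  fix \<sigma> \<sigma>' assume "\<sigma> \<in> slope ` P" "ray_of \<sigma> = ray_of \<sigma>'"
  then obtain x where "x \<in> fiber \<sigma>" "fiber \<sigma> = fiber \<sigma>'" using Int_ray_of by (metis (mono_tags, lifting) image_iff mem_Collect_eq)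
  then show "\<sigma> = \<sigma>'" by auto
qed

lemma sum_occupied_rays:
  "(\<Sum>R\<in>occupied_rays P. f (card (P \<inter> R))) = (\<Sum>\<sigma>\<in>slope ` P. f (card (fiber \<sigma>)))"
  by (simp add: occupied_rays_eq sum.reindex[OF inj_ray_of] Int_ray_of)

lemma card_occupied_rays: "card (occupied_rays P) = card (slope ` P)"
  by (simp add: occupied_rays_eq card_image[OF inj_ray_of])

lemma sum_card_fiber: "(\<Sum>\<sigma>\<in>slope ` P. card (fiber \<sigma>)) = card P"
  using sum.image_gen[OF finite_P, of "\<lambda>_. 1 :: nat" slope] by simp

lemma sum_card_occupied_rays: "(\<Sum>R\<in>occupied_rays P. card (P \<inter> R)) = card P"
  using sum_occupied_rays[of "\<lambda>n. n"] sum_card_fiber by simp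

text \<open>Each of the \<open>a\<close> points on a ray is charged \<open>a ^ 2\<close>; this is
  the form required by \<open>sum_le_powr_card\<close>.\<close>

lemma ray_cube_sum_eq: "ray_cube_sum P = (\<Sum>x\<in>P. real (card (fiber (slope x))) ^ 2)"
proof -
  have "(\<Sum>x\<in>P. real (card (fiber (slope x))) ^ 2) =
      (\<Sum>\<sigma>\<in>slope ` P. \<Sum>x\<in>fiber \<sigma>. real (card (fiber (slope x))) ^ 2)"
    by (rule sum.image_gen[OF finite_P])
  also have "\<dots> = (\<Sum>\<sigma>\<in>slope ` P. real (card (fiber \<sigma>)) ^ 3)"
    by (intro sum.cong refl) (simp add: power2_eq_square power3_eq_cube)
  finally show ?thesis using sum_occupied_rays[of "\<lambda>n. real n ^ 3"] by (simp add: ray_cube_sum_def)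
qed

lemma pinned_eq: "pinned_dot_products P p = along ` P"
  by (auto simp: pinned_dot_products_def along_def)

lemma finite_dot_products: "finite (dot_products P)"
proof -
  have "dot_products P = (\<lambda>(x, y). x \<bullet> y) ` (P \<times> P)" by (auto simp: dot_products_def)
  then show ?thesis using finite_P by simp
qed

lemma card_pinned_le: "card (pinned_dot_products P p) \<le> card (dot_products P)"
  by (rule card_mono[OF finite_dot_products])
     (use p_in_P in \<open>auto simp: pinned_dot_products_def dot_products_def\<close>)

lemma card_pinned_pos: "0 < card (pinned_dot_products P p)"
  using p_in_P finite_P by (auto simp: pinned_eq card_gt_0_iff)

lemma card_fiber_le: "card (fiber \<sigma>) \<le> card (pinned_dot_products P p)"
  unfolding pinned_eq
  by (rule card_inj_on_le[of along]) (auto simp: inj_on_def across_eq finite_P intro!: eqI)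

lemma card_fiber_pos: "x \<in> P \<Longrightarrow> 0 < card (fiber (slope x))"
  using finite_P by (auto simp: card_gt_0_iff)

text \<open>\<open>P\<close> lies on as many lines orthogonal to \<open>p\<close> as there are
  pinned products, so one of them carries a proportional share of the level set. The slopes of one
  sign on it form \<open>Y\<close>, scaling by the line gives radius 1 on each ray, and
  \<open>card_Y_cube\<close> applies with \<open>m = card Y\<close>.\<close>

lemma level_set_bound:
  assumes x0: "x0 \<in> P"
  defines "a \<equiv> card (fiber (slope x0))"
  shows "\<exists>m \<ge> 1. card {x \<in> P. a \<le> card (fiber (slope x))} \<le> 2 * card (pinned_dot_products P p) * m \<and>
    m ^ 3 * a ^ 8 \<le> 4913 * card (dot_products P) ^ 9"
proof -
  define S where "S = {x \<in> P. a \<le> card (fiber (slope x))}"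
  have S: "finite S" "x0 \<in> S" "S \<subseteq> P" using finite_P x0 by (auto simp: S_def a_def)
  have "\<exists>l\<in>along ` S. card S \<le> card {x \<in> S. along x = l} * card (along ` P)"
  proof (rule ccontr)
    assume neg: "\<not> ?thesis"
    have "card S * card (along ` P) = (\<Sum>l\<in>along ` S. card {x \<in> S. along x = l}) * card (along ` P)"
      using sum.image_gen[OF S(1), of "\<lambda>_. 1 :: nat" along] by simp
    also have "\<dots> = (\<Sum>l\<in>along ` S. card {x \<in> S. along x = l} * card (along ` P))"
      by (rule sum_distrib_right)
    also have "\<dots> < (\<Sum>l\<in>along ` S. card S)"
      using neg S by (intro sum_strict_mono) (auto simp: not_le)
    also have "\<dots> = card S * card (along ` S)" by simp
    also have "\<dots> \<le> card S * card (along ` P)"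
      using S finite_P by (intro mult_le_mono2 card_mono image_mono) auto
    finally show False by simp
  qed
  then obtain l where l: "l \<in> along ` S" "card S \<le> card {x \<in> S. along x = l} * card (along ` P)" by blast
  have "l > 0" using l(1) along_pos S(3) by auto
  have "card S > 0" using S by (auto simp: card_gt_0_iff)
  \<comment> \<open>The locale \<open>radii\<close> asks for nonnegative slopes, so the more
    frequent sign \<open>e\<close> is chosen, which costs a factor 2. Multiplying all slopes by
    \<open>e\<close> keeps their pairwise products.\<close>
  define Z where "Z e = {x \<in> S. along x = l \<and> 0 \<le> e * slope x}" for e :: real
  have finZ: "finite (Z e)" for e using S by (simp add: Z_def)
  have "card {x \<in> S. along x = l} \<le> card (Z 1 \<union> Z (-1))"
    by (intro card_mono finite_UnI finZ) (auto simp: Z_def)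
  also have "\<dots> \<le> card (Z 1) + card (Z (-1))" by (rule card_Un_le)
  finally have "\<exists>e\<in>{1, -1}. card {x \<in> S. along x = l} \<le> 2 * card (Z e)" by auto
  then obtain e where e: "e = 1 \<or> e = -1" "card {x \<in> S. along x = l} \<le> 2 * card (Z e)" by blast
  have ee: "e * e = 1" "e \<noteq> 0" using e(1) by auto
  define Y where "Y = (\<lambda>x. e * slope x) ` Z e"
  define X where "X y = (\<lambda>x. along x / l) ` fiber (e * y)" for y
  define L where "L = (\<lambda>t. (p \<bullet> p) * t / l ^ 2) ` dot_products P"
  have ZP: "x \<in> P" if "x \<in> Z e" for x using that S by (auto simp: Z_def)
  have e_slope: "e * (e * s) = s" for s using ee by (simp flip: mult.assoc)
  have cardX: "card (X y) = card (fiber (e * y))" for y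
    unfolding X_def using \<open>l > 0\<close> by (intro card_image) (auto simp: inj_on_def across_eq intro!: eqI)
  \<comment> \<open>On the line where \<open>along\<close> equals \<open>l\<close> the slope
    determines the point.\<close>
  have cardY: "card Y = card (Z e)"
    unfolding Y_def using ee ZP by (intro card_image) (auto simp: inj_on_def Z_def across_eq intro!: eqI)
  have cardL: "card L \<le> card (dot_products P)"
    unfolding L_def by (rule card_image_le[OF finite_dot_products])
  have "radii Y X L a"
  proof
    fix y assume y: "y \<in> Y"
    then obtain x where x: "x \<in> Z e" "y = e * slope x" by (auto simp: Y_def)
    show "0 \<le> y" using x by (simp add: Z_def)
    show "finite (X y)" using finite_P by (simp add: X_def)
    have "x \<in> fiber (e * y)" using x ZP by (simp add: e_slope)
    moreover have "1 = along x / l" using x \<open>l > 0\<close> by (simp add: Z_def)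
    ultimately show "1 \<in> X y" unfolding X_def by (rule image_eqI[rotated])
    show "a \<le> card (X y)" using x S by (simp add: cardX e_slope Z_def S_def)
    show "0 < r" if "r \<in> X y" for r using that along_pos \<open>l > 0\<close> by (auto simp: X_def)
    fix z r s assume *: "z \<in> Y" "r \<in> X y" "s \<in> X z"
    then obtain x1 x2 where x12: "x1 \<in> P" "slope x1 = e * y" "r = along x1 / l"
      "x2 \<in> P" "slope x2 = e * z" "s = along x2 / l" by (auto simp: X_def)
    have "slope x1 * slope x2 = y * z" using ee x12 by (simp add: algebra_simps)
    then have "(1 + y * z) * r * s = (p \<bullet> p) * (x1 \<bullet> x2) / l ^ 2"
      using x12 by (simp add: inner_eq_slope power2_eq_square)
    then show "(1 + y * z) * r * s \<in> L"
      using x12 unfolding L_def dot_products_def by blast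
  qed (use finite_dot_products in \<open>simp add: L_def\<close>)
  then interpret radii Y X L a .
  have "Z e \<noteq> {}" using l(2) e(2) \<open>card S > 0\<close> by (intro notI) simp
  then have "1 \<le> card Y" "Y \<noteq> {}" "finite Y"
    using finZ cardY by (auto simp: Y_def card_gt_0_iff Suc_le_eq)
  moreover have "card S \<le> 2 * card (pinned_dot_products P p) * card Y"
  proof -
    have "card S \<le> (2 * card (Z e)) * card (along ` P)"
      using l(2) e(2) by (meson le_trans mult_le_mono1)
    then show ?thesis by (simp add: pinned_eq cardY mult_ac)
  qed
  moreover have "card Y ^ 3 * a ^ 8 \<le> 4913 * card (dot_products P) ^ 9"
    using card_Y_cube[OF \<open>finite Y\<close> \<open>Y \<noteq> {}\<close>] cardL power_mono[OF cardL, of 9] by linarith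
  ultimately show ?thesis unfolding S_def by blast
qed

text \<open>With one pin on each ray, sorted by slope, the inner products with the pins turn each
  point into a pseudoline. All its heights lie in \<open>dot_products P\<close>, so every point is
  an edge in every strip of \<open>pseudoline_grid_bound\<close>.\<close>

lemma card_slopes_bound: "card (slope ` P) * card P \<le> 256 * card (dot_products P) ^ 2"
proof -
  define D where "D = card (slope ` P)"
  define N where "N = card P"
  define t where "t = card (dot_products P)"
  have t: "1 \<le> t" using card_pinned_pos card_pinned_le by (simp add: t_def)
  have D_le: "D \<le> N" unfolding D_def N_def by (rule card_image_le[OF finite_P])
  have "N = (\<Sum>\<sigma>\<in>slope ` P. card (fiber \<sigma>))" by (simp add: sum_card_fiber N_def)
  also have "\<dots> \<le> (\<Sum>\<sigma>\<in>slope ` P. t)"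
    using card_fiber_le card_pinned_le unfolding t_def by (intro sum_mono) (meson le_trans)
  finally have N_le: "N \<le> D * t" by (simp add: D_def)
  have t2: "t \<le> t ^ 2" using t by (simp add: power2_eq_square)
  \<comment> \<open>The main case needs at least two strips and \<open>N div (4 * t) > 0\<close>;
    otherwise \<open>N \<le> D * t\<close> or \<open>D \<le> N\<close> is enough.\<close>
  consider "D \<le> 2" | "N < 4 * t" | "D > 2" "4 * t \<le> N" by linarith
  then have "D * N \<le> 256 * t ^ 2"
  proof cases
    case 1
    then have "D * N \<le> 2 * (2 * t)" using N_le by (intro mult_le_mono) (auto intro: le_trans)
    then show ?thesis using t2 by linarith
  next
    case 2
    then have "D * N \<le> (4 * t) * (4 * t)" using D_le by (intro mult_le_mono) auto
    then show ?thesis by (simp add: power2_eq_square)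
  next
    case 3
    define n where "n = D - 1"
    define \<sigma> where "\<sigma> i = sorted_list_of_set (slope ` P) ! i" for i
    have n: "n \<ge> 2" "D = Suc n" using 3 by (auto simp: n_def)
    have \<sigma>_mem: "\<sigma> i \<in> slope ` P" if "i \<le> n" for i
      using that n finite_P nth_mem[of i "sorted_list_of_set (slope ` P)"] by (simp add: \<sigma>_def D_def)
    have \<sigma>_less: "\<sigma> i < \<sigma> j" if "i < j" "j \<le> n" for i j
      using that n finite_P unfolding \<sigma>_def D_def
      by (intro sorted_wrt_nth_less[OF strict_sorted_list_of_set]) auto
    have "\<forall>i. \<exists>x. i \<le> n \<longrightarrow> x \<in> P \<and> slope x = \<sigma> i" using \<sigma>_mem by (metis imageE)
    then obtain q where q: "\<And>i. i \<le> n \<Longrightarrow> q i \<in> P \<and> slope (q i) = \<sigma> i" by metis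
    define \<phi> where "\<phi> i x = q i \<bullet> x" for i x
    \<comment> \<open>Up to positive factors, the difference of two pseudolines is an affine
      function of the slope of the pin.\<close>
    have sign: "\<phi> i x \<le> \<phi> i y \<longleftrightarrow> along (x - y) + \<sigma> i * across (x - y) \<le> 0"
      "\<phi> i y \<le> \<phi> i x \<longleftrightarrow> 0 \<le> along (x - y) + \<sigma> i * across (x - y)" if "i \<le> n" for i x y
    proof -
      have "(p \<bullet> p) * (\<phi> i x - \<phi> i y) = (p \<bullet> p) * (q i \<bullet> (x - y))"
        by (simp add: \<phi>_def inner_diff_right)
      also have "\<dots> = along (q i) * (along (x - y) + \<sigma> i * across (x - y))"
        unfolding inner_eq using q[OF that] across_eq[of "q i"] by (simp add: algebra_simps)
      finally have *: "(p \<bullet> p) * (\<phi> i x - \<phi> i y) = along (q i) * (along (x - y) + \<sigma> i * across (x - y))" .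
      have "0 < along (q i)" using q[OF that] along_pos by blast
      note signs = same_signs[OF pp_pos this *]
      show "\<phi> i x \<le> \<phi> i y \<longleftrightarrow> along (x - y) + \<sigma> i * across (x - y) \<le> 0"
        using signs(1) by linarith
      show "\<phi> i y \<le> \<phi> i x \<longleftrightarrow> 0 \<le> along (x - y) + \<sigma> i * across (x - y)"
        using signs(2) by linarith
    qed
    have single: "\<not> (\<phi> h x \<le> \<phi> h y \<and> \<phi> i y \<le> \<phi> i x \<and> \<phi> j x \<le> \<phi> j y)"
      if "x \<in> P" "y \<in> P" "x \<noteq> y" "h < i" "i < j" "j \<le> n" for x y h i j
    proof
      assume *: "\<phi> h x \<le> \<phi> h y \<and> \<phi> i y \<le> \<phi> i x \<and> \<phi> j x \<le> \<phi> j y"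
      define u v where "u = along (x - y)" and "v = across (x - y)"
      have le: "h \<le> n" "i \<le> n" "j \<le> n" using that by linarith+
      have signs: "u + \<sigma> h * v \<le> 0" "0 \<le> u + \<sigma> i * v" "u + \<sigma> j * v \<le> 0"
        using * sign(1)[OF le(1), of x y] sign(2)[OF le(2), of y x] sign(1)[OF le(3), of x y]
        unfolding u_def v_def by blast+
      have "\<sigma> h < \<sigma> i" "\<sigma> i < \<sigma> j" using \<sigma>_less[OF that(4) le(2)] \<sigma>_less[OF that(5) le(3)] .
      \<comment> \<open>An affine function that is nonpositive, nonnegative and nonpositive at three
        increasing slopes must vanish identically.\<close>
      then have "0 < v \<Longrightarrow> \<sigma> i * v < \<sigma> j * v" "v < 0 \<Longrightarrow> \<sigma> i * v < \<sigma> h * v"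
        by (auto intro: mult_strict_right_mono mult_strict_right_mono_neg)
      with signs have "v = 0" by linarith
      with signs have "u = 0" by simp
      with \<open>v = 0\<close> have "x - y = 0" unfolding u_def v_def by (intro eq_zeroI)
      with that show False by simp
    qed
    \<comment> \<open>\<open>4 * t * k \<le> N\<close> makes the grid term at most half of the left
      side, and \<open>N \<le> 8 * t * k\<close> bounds \<open>k\<close> from below at the
      end.\<close>
    define k where "k = N div (4 * t)"
    have k: "4 * t * k \<le> N" "k > 0" "N \<le> 8 * t * k"
    proof -
      show "4 * t * k \<le> N" by (simp add: k_def)
      show "k > 0" using 3 t by (simp add: k_def div_greater_zero_iff)
      then have "4 * t \<le> 4 * t * k" by simp
      moreover have "N = 4 * t * k + N mod (4 * t)" "N mod (4 * t) < 4 * t" using t by (auto simp: k_def)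
      ultimately show "N \<le> 8 * t * k" by linarith
    qed
    have "{x \<in> P. \<phi> i x \<in> dot_products P \<and> \<phi> (Suc i) x \<in> dot_products P} = P" if "i < n" for i
      using q[of i] q[of "Suc i"] that by (auto simp: \<phi>_def dot_products_def)
    moreover have "k ^ 2 * (\<Sum>i<n. card {x \<in> P. \<phi> i x \<in> dot_products P \<and> \<phi> (Suc i) x \<in> dot_products P})
        \<le> 2 * n * k ^ 3 * card (dot_products P) + (card P)\<^sup>2"
      by (intro pseudoline_grid_bound finite_P finite_dot_products k n single)
    ultimately have "k ^ 2 * (n * N) \<le> 2 * n * k ^ 3 * t + N ^ 2"
      by (simp add: N_def t_def)
    moreover have "2 * (2 * n * k ^ 3 * t) \<le> k ^ 2 * (n * N)"
    proof -
      have "2 * (2 * n * k ^ 3 * t) = k ^ 2 * n * (4 * t * k)"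
        by (simp add: power2_eq_square power3_eq_cube)
      also have "\<dots> \<le> k ^ 2 * n * N" by (rule mult_le_mono2[OF k(1)])
      finally show ?thesis by (simp only: mult.assoc)
    qed
    ultimately have "k ^ 2 * (n * N) \<le> 2 * N ^ 2" by linarith
    then have "N * (k ^ 2 * n) \<le> N * (2 * N)"
      by (simp only: power2_eq_square mult_ac)
    then have kn: "k ^ 2 * n \<le> 2 * N" using 3 t by simp
    have "N ^ 2 \<le> (8 * t * k) ^ 2" using k(3) by (intro power_mono) auto
    then have "n * N ^ 2 \<le> n * (8 * t * k) ^ 2" by (rule mult_le_mono2)
    also have "\<dots> = 64 * t ^ 2 * (k ^ 2 * n)" by (simp add: power_mult_distrib)
    also have "\<dots> \<le> 64 * t ^ 2 * (2 * N)" using kn by (rule mult_le_mono2)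
    finally have "N * (n * N) \<le> N * (128 * t ^ 2)" by (simp only: power2_eq_square mult_ac)
    then have "n * N \<le> 128 * t ^ 2" using 3 t by simp
    moreover have "D * N \<le> 2 * n * N" using n by (intro mult_le_mono1) auto
    ultimately show ?thesis by linarith
  qed
  then show ?thesis by (simp add: D_def N_def t_def)
qed

text \<open>The fourth root of \<open>m ^ 3 * a ^ 8 \<le> 4913 * t ^ 9\<close> bounds
  \<open>a ^ 2\<close>. With the size of the level set in terms of \<open>m\<close>, this is the
  hypothesis of \<open>sum_le_powr_card\<close> for the exponent 31/42.\<close>

lemma ray_cube_sum_le:
  "ray_cube_sum P \<le> 80 * real (card (pinned_dot_products P p)) powr (31 / 42)
    * real (card (dot_products P)) powr (16 / 7) * real (card P) powr (11 / 42)"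
proof -
  define \<tau> t where "\<tau> = real (card (pinned_dot_products P p))" and "t = real (card (dot_products P))"
  have \<tau>: "1 \<le> \<tau>" "\<tau> \<le> t"
    using card_pinned_pos card_pinned_le by (simp_all add: \<tau>_def t_def Suc_le_eq)
  define A where "A = 20 * (\<tau> powr (31 / 42) * t powr (16 / 7))"
  define w where "w x = real (card (fiber (slope x))) ^ 2" for x
  have "w x * real (card {y \<in> P. w x \<le> w y}) powr (31 / 42) \<le> A" if x: "x \<in> P" for x
  proof -
    define a where "a = card (fiber (slope x))"
    define M where "M = card {y \<in> P. w x \<le> w y}"
    have M: "M = card {y \<in> P. a \<le> card (fiber (slope y))}"
      by (simp add: M_def w_def a_def power_mono_iff)
    obtain m where m: "m \<ge> 1" "M \<le> 2 * card (pinned_dot_products P p) * m"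
      "m ^ 3 * a ^ 8 \<le> 4913 * card (dot_products P) ^ 9"
      using level_set_bound[OF x] unfolding M a_def by blast
    have a: "a > 0" using card_fiber_pos[OF x] by (simp add: a_def)
    have "real m ^ 3 * real a ^ 8 \<le> 4913 * t ^ 9"
      using of_nat_mono[OF m(3), where 'a = real] unfolding t_def of_nat_mult of_nat_power of_nat_numeral .
    then have "(real m ^ 3 * real a ^ 8) powr (1 / 4) \<le> (4913 * t ^ 9) powr (1 / 4)"
      using m(1) a by (intro powr_mono2) auto
    moreover have "(real m ^ 3 * real a ^ 8) powr (1 / 4) = real m powr (3 / 4) * real a ^ 2"
      using m(1) a by (simp add: powr_mult powr_powr flip: powr_numeral)
    moreover have "(4913 * t ^ 9) powr (1 / 4) = 4913 powr (1 / 4) * t powr (9 / 4)"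
      using \<tau> by (simp add: powr_mult powr_powr flip: powr_numeral)
    moreover have "4913 powr (1 / 4) \<le> (10 :: real)"
      using powr_mono2[of "1 / 4" 4913 "10000 :: real"] powr_powr[of "10 :: real" 4 "1 / 4"] by simp
    \<comment> \<open>The exponents 9/4 of \<open>t\<close> and 3/4 of \<open>m\<close> are relaxed
      to 16/7 and 31/42, which is allowed since \<open>t\<close> and \<open>m\<close> are at least
      1.\<close>
    moreover have "t powr (9 / 4) \<le> t powr (16 / 7)"
      using \<tau> by (intro powr_mono) auto
    ultimately have "real m powr (3 / 4) * real a ^ 2 \<le> 10 * t powr (16 / 7)"
      using mult_mono[of "4913 powr (1 / 4)" 10 "t powr (9 / 4)" "t powr (16 / 7)"] by simp
    moreover have "real m powr (31 / 42) * real a ^ 2 \<le> real m powr (3 / 4) * real a ^ 2"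
      using m(1) by (intro mult_right_mono powr_mono) auto
    ultimately have ma: "real m powr (31 / 42) * real a ^ 2 \<le> 10 * t powr (16 / 7)" by linarith
    have "real M \<le> 2 * \<tau> * real m"
      using of_nat_mono[OF m(2), where 'a = real] unfolding \<tau>_def of_nat_mult of_nat_numeral .
    then have "real M powr (31 / 42) \<le> (2 * \<tau> * real m) powr (31 / 42)"
      by (intro powr_mono2) auto
    also have "\<dots> = 2 powr (31 / 42) * \<tau> powr (31 / 42) * real m powr (31 / 42)"
      using \<tau> by (simp add: powr_mult)
    also have "\<dots> \<le> 2 * \<tau> powr (31 / 42) * real m powr (31 / 42)"
      using powr_mono[of "31 / 42" 1 "2 :: real"] by (intro mult_right_mono) auto
    finally have "real a ^ 2 * real M powr (31 / 42) \<le> real a ^ 2 * (2 * \<tau> powr (31 / 42) * real m powr (31 / 42))"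
      by (intro mult_left_mono) auto
    also have "\<dots> = 2 * \<tau> powr (31 / 42) * (real m powr (31 / 42) * real a ^ 2)"
      by simp
    also have "\<dots> \<le> 2 * \<tau> powr (31 / 42) * (10 * t powr (16 / 7))"
      using ma by (intro mult_left_mono) auto
    finally show ?thesis by (simp add: A_def w_def M_def a_def)
  qed
  then have "sum w P \<le> A / (1 - 31 / 42) * real (card P) powr (1 - 31 / 42)"
    by (intro sum_le_powr_card finite_P) (auto simp: A_def w_def)
  \<comment> \<open>Here \<open>1 / (1 - 31 / 42) = 42 / 11 \<le> 4\<close>, so the final constant
    is 4 * 20.\<close>
  also have "\<dots> \<le> 4 * A * real (card P) powr (11 / 42)"
  proof -
    have "0 \<le> A" by (simp add: A_def)
    then show ?thesis by (simp add: mult_right_mono)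
  qed
  finally show ?thesis
    by (simp add: ray_cube_sum_eq w_def A_def \<tau>_def t_def mult_ac)
qed

lemma J_ge_1: "J P p \<ge> 1"
  using card_pinned_pos card_pinned_le by (simp add: J_def)

text \<open>Cauchy-Schwarz twice, through the sum \<open>B\<close> of squares:
  \<open>N ^ 2 \<le> D * B\<close>, and \<open>B ^ 2\<close> is at most \<open>N\<close> times the
  sum of cubes.\<close>

lemma H2_ge_1: "H2 P \<ge> 1"
proof -
  define D N where "D = real (card (slope ` P))" and "N = real (card P)"
  define a where "a \<sigma> = real (card (fiber \<sigma>))" for \<sigma>
  have N: "N > 0" using p_in_P finite_P by (auto simp: N_def card_gt_0_iff)
  have sum_a: "sum a (slope ` P) = N"
    using sum_card_fiber unfolding a_def N_def by (simp flip: of_nat_sum)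
  have cube: "ray_cube_sum P = (\<Sum>\<sigma>\<in>slope ` P. a \<sigma> ^ 3)"
    using sum_occupied_rays[of "\<lambda>n. real n ^ 3"] by (simp add: ray_cube_sum_def a_def)
  define B where "B = (\<Sum>\<sigma>\<in>slope ` P. a \<sigma> ^ 2)"
  have "N ^ 2 \<le> D * B"
    using Cauchy_Schwarz_ineq_sum[of "\<lambda>_. 1" a "slope ` P"] by (simp add: sum_a D_def B_def)
  then have "(N ^ 2) ^ 2 \<le> (D * B) ^ 2" by (intro power_mono) auto
  also have "\<dots> = D ^ 2 * B ^ 2" by (rule power_mult_distrib)
  also have "\<dots> \<le> D ^ 2 * (N * ray_cube_sum P)"
  proof (rule mult_left_mono)
    show "B ^ 2 \<le> N * ray_cube_sum P"
    proof -
      have "sqrt (a \<sigma>) * (a \<sigma> * sqrt (a \<sigma>)) = a \<sigma> ^ 2" "(a \<sigma> * sqrt (a \<sigma>))\<^sup>2 = a \<sigma> ^ 3"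
        "(sqrt (a \<sigma>))\<^sup>2 = a \<sigma>" for \<sigma>
        by (simp_all add: a_def power_mult_distrib power2_eq_square power3_eq_cube)
      then show ?thesis
        using Cauchy_Schwarz_ineq_sum[of "\<lambda>\<sigma>. sqrt (a \<sigma>)" "\<lambda>\<sigma>. a \<sigma> * sqrt (a \<sigma>)" "slope ` P"]
        by (simp add: B_def cube sum_a)
    qed
  qed simp
  finally have "N * N ^ 3 \<le> N * (D ^ 2 * ray_cube_sum P)"
    by (simp only: power2_eq_square power3_eq_cube mult_ac)
  then have "N ^ 3 \<le> D ^ 2 * ray_cube_sum P" using N by simp
  then show ?thesis
    using N by (simp add: H2_def card_occupied_rays D_def N_def)
qed

text \<open>Both \<open>D \<le> 256 * t ^ 2 / N\<close> and the bound on the cube sum are inserted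
  into \<open>H2\<close>, with the pinned count written as \<open>t / j\<close>; then the power
  42/295 is taken.\<close>

lemma card_dot_products_ge:
  "real (card (dot_products P)) \<ge> 1 / 5242880 * H2 P powr (42 / 295) * J P p powr (31 / 295)
    * real (card P) powr (199 / 295)"
proof -
  define t \<tau> D N S where "t = real (card (dot_products P))"
    and "\<tau> = real (card (pinned_dot_products P p))" and "D = real (card (slope ` P))"
    and "N = real (card P)" and "S = ray_cube_sum P"
  have pos: "t > 0" "\<tau> > 0" "N > 0" "D \<ge> 0"
    using card_pinned_pos order_less_le_trans[OF card_pinned_pos card_pinned_le] p_in_P finite_P
    by (auto simp: t_def \<tau>_def N_def D_def card_gt_0_iff)
  define h j where "h = H2 P" and "j = J P p"
  have h: "h \<ge> 1" "h = D ^ 2 * S / N ^ 3"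
    using H2_ge_1 by (simp_all add: h_def H2_def S_def D_def N_def card_occupied_rays)
  have j: "j \<ge> 1" "\<tau> = t / j"
    using J_ge_1 pos by (simp_all add: j_def J_def t_def \<tau>_def)
  have S: "S \<le> 80 * \<tau> powr (31 / 42) * t powr (16 / 7) * N powr (11 / 42)"
    using ray_cube_sum_le by (simp add: S_def \<tau>_def t_def N_def)
  have "D * N \<le> 256 * t ^ 2"
    using of_nat_mono[OF card_slopes_bound, where 'a = real]
    unfolding D_def N_def t_def of_nat_mult of_nat_power of_nat_numeral .
  then have "D \<le> 256 * t ^ 2 / N" using pos by (simp add: field_simps)
  then have "D ^ 2 \<le> (256 * t ^ 2 / N) ^ 2" using pos by (intro power_mono) auto
  also have "\<dots> = 65536 * t ^ 4 / N ^ 2" by (simp add: power_divide power_mult_distrib flip: power_mult)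
  finally have D2: "D ^ 2 \<le> 65536 * t ^ 4 / N ^ 2" .
  have "h \<le> (65536 * t ^ 4 / N ^ 2) * (80 * \<tau> powr (31 / 42) * t powr (16 / 7) * N powr (11 / 42)) / N ^ 3"
    unfolding h(2) using D2 S pos
    by (intro divide_right_mono mult_mono) (auto simp: S_def ray_cube_sum_def intro!: sum_nonneg)
  also have "\<dots> = 5242880 * t powr (295 / 42) / (j powr (31 / 42) * N powr (199 / 42))"
  proof -
    \<comment> \<open>The exponent of \<open>t\<close> collects 4 from \<open>D ^ 2\<close>, 31/42
      from the pinned count and 16/7 from the cube sum; that of \<open>N\<close> is
      \<open>5 - 11 / 42 = 199 / 42\<close> in the denominator.\<close>
    have "t powr (295 / 42) = t powr (4 + 31 / 42 + 16 / 7)" by simp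
    also have "\<dots> = t ^ 4 * t powr (31 / 42) * t powr (16 / 7)"
      unfolding powr_add using pos by simp
    finally have t_powr: "t powr (295 / 42) = t ^ 4 * t powr (31 / 42) * t powr (16 / 7)" .
    have \<tau>_powr: "\<tau> powr (31 / 42) = t powr (31 / 42) / j powr (31 / 42)"
      using pos j by (simp add: powr_divide)
    have "N powr (11 / 42) * N powr (199 / 42) = N ^ 2 * N ^ 3"
      using pos by (simp flip: powr_add power_add)
    then have N_powr: "N powr (11 / 42) / (N ^ 2 * N ^ 3) = 1 / N powr (199 / 42)"
      using pos by (simp add: frac_eq_eq)
    have "(65536 * t ^ 4 / N ^ 2) * (80 * \<tau> powr (31 / 42) * t powr (16 / 7) * N powr (11 / 42)) / N ^ 3
        = (65536 * t ^ 4) * (80 * \<tau> powr (31 / 42) * t powr (16 / 7)) * (N powr (11 / 42) / (N ^ 2 * N ^ 3))"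
      by (simp add: mult_ac)
    also have "\<dots> = 5242880 * t powr (295 / 42) / (j powr (31 / 42) * N powr (199 / 42))"
      unfolding N_powr \<tau>_powr t_powr by simp
    finally show ?thesis .
  qed
  finally have "h * (j powr (31 / 42) * N powr (199 / 42)) \<le> 5242880 * t powr (295 / 42)"
    using pos j by (subst (asm) pos_le_divide_eq) auto
  then have "h * j powr (31 / 42) * N powr (199 / 42) \<le> 5242880 * t powr (295 / 42)"
    by (simp only: mult.assoc)
  then have "(h * j powr (31 / 42) * N powr (199 / 42)) powr (42 / 295) \<le> (5242880 * t powr (295 / 42)) powr (42 / 295)"
    using h(1) j(1) pos by (intro powr_mono2 mult_nonneg_nonneg) auto
  then have "h powr (42 / 295) * j powr (31 / 295) * N powr (199 / 295) \<le> 5242880 powr (42 / 295) * t"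
    using h(1) j(1) pos by (simp add: powr_mult powr_powr)
  also have "\<dots> \<le> 5242880 * t"
    using pos powr_mono[of "42 / 295" 1 "5242880 :: real"] by (intro mult_right_mono) auto
  finally show ?thesis by (simp add: h_def j_def N_def t_def mult_ac)
qed

end

theorem theorem5p1:
  "\<exists>C c :: real. C > 0 \<and> c > 0 \<and>
    (\<forall>P :: (real^2) set.
      finite P \<longrightarrow> P \<noteq> {} \<longrightarrow> 0 \<notin> P \<longrightarrow>
      (\<exists>\<alpha> \<phi>. 0 < \<phi> \<and> \<phi> < pi / 2 \<and> P \<subseteq> angular_sector \<alpha> \<phi>) \<longrightarrow>
      (\<Sum>R\<in>occupied_rays P. card (P \<inter> R)) = card P \<and>
      (\<forall>p\<in>P.
        ray_cube_sum P
          \<le> C * real (card (pinned_dot_products P p)) powr (31 / 42)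
              * real (card (dot_products P)) powr (16 / 7)
              * real (card P) powr (11 / 42) \<and>
        H2 P \<ge> 1 \<and> J P p \<ge> 1 \<and>
        real (card (dot_products P))
          \<ge> c * H2 P powr (42 / 295) * J P p powr (31 / 295)
              * real (card P) powr (199 / 295)))"
proof (rule exI[of _ 80], rule exI[of _ "1 / 5242880"], intro conjI allI impI)
  fix P :: "(real^2) set"
  assume P: "finite P" "P \<noteq> {}" "0 \<notin> P"
    and "\<exists>\<alpha> \<phi>. 0 < \<phi> \<and> \<phi> < pi / 2 \<and> P \<subseteq> angular_sector \<alpha> \<phi>"
  then obtain \<alpha> \<phi> where sector: "\<phi> < pi / 2" "P \<subseteq> angular_sector \<alpha> \<phi>" by blast
  have acute: "acute_set P p" if "p \<in> P" for p
    using P that angular_sector_inner_pos[OF sector(2,1) P(3)] by unfold_locales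
  then show "(\<Sum>R\<in>occupied_rays P. card (P \<inter> R)) = card P"
    using P(2) acute_set.sum_card_occupied_rays by blast
  show "\<forall>p\<in>P.
        ray_cube_sum P
          \<le> 80 * real (card (pinned_dot_products P p)) powr (31 / 42)
              * real (card (dot_products P)) powr (16 / 7)
              * real (card P) powr (11 / 42) \<and>
        H2 P \<ge> 1 \<and> J P p \<ge> 1 \<and>
        real (card (dot_products P))
          \<ge> 1 / 5242880 * H2 P powr (42 / 295) * J P p powr (31 / 295)
              * real (card P) powr (199 / 295)"
    using acute acute_set.ray_cube_sum_le acute_set.H2_ge_1 acute_set.J_ge_1
      acute_set.card_dot_products_ge by blast
qed simp_all

end
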